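(* Let $v$ be a typical weight, let $T$ be an intrinsic operator on $\mathcal{H}(\mathbb{D})$ and let $X$ be an initial space. (i) Suppose $T:X\to H_v$ is bounded. Then $T:X\to H_v$ is compact (respectively weakly compact) if and only if the set $\{v(z)T^*K_z^H: z\in\mathbb{D}\}$ is relatively compact (respectively relatively weakly compact) in $X^*$. (ii) Suppose $T:X\to\mathcal{B}_v$ is bounded. Then $T:X\to\mathcal{B}_v$ is compact (respectively weakly compact) if and only if the set $\{v(z)T^*K_{z,1}^{\mathcal{B}}: z\in\mathbb{D}\}$ is relatively compact (respectively relatively weakly compact) in $X^*$.
   Context: $\mathcal{H}(\mathbb{D})$ is the space of holomorphic functions on the unit disk $\mathbb{D}$ with the topology $\tau_{uc}$ of uniform convergence on compact subsets. A linear operator $T$ on $\mathcal{H}(\mathbb{D})$ is intrinsic if it maps $\tau_{uc}$-convergent sequences to $\tau_{uc}$-convergent sequences. An initial space is a Banach space $X\subset\mathcal{H}(\mathbb{D})$ containing the polynomials such that every sequence in the closed unit ball of $X$ has a subsequence converging in $\tau_{uc}$ to some function in $X$. A typical weight is a continuous radial $v:\mathbb{D}\to(0,1]$, non-increasing in $|z|$, with $v(z)\to0$ as $|z|\to1$. $H_v=\{f\in\mathcal{H}(\mathbb{D}):\sup_z v(z)|f(z)|<\infty\}$ with that supremum as norm; $\mathcal{B}_v=\{f:\sup_z v(z)|f'(z)|<\infty\}$ with norm $|f(0)|+\sup_z v(z)|f'(z)|$. $K_z^H\in H_v^*$ is the point evaluation $g\mapsto g(z)$ and $K_{z,1}^{\mathcal{B}}\in\mathcal{B}_v^*$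 the derivative point evaluation $g\mapsto g'(z)$. $T^*$ denotes the Banach-space adjoint of $T:X\to H_v$ (resp. $T:X\to\mathcal{B}_v$). *)

theory Defs
  imports "HOL-Analysis.Analysis" "HOL-Computational_Algebra.Polynomial" "HOL-Library.Function_Algebras"
begin

text \<open>All spaces considered are sets V of complex-valued functions (on some type 'b)
  with a norm N :: ('b => complex) => real; vector operations are pointwise.\<close>

definition csmul :: "complex \<Rightarrow> ('b \<Rightarrow> complex) \<Rightarrow> ('b \<Rightarrow> complex)" where
  "csmul c f = (\<lambda>x. c * f x)"

definition is_banach_fs :: "('b \<Rightarrow> complex) set \<Rightarrow> (('b \<Rightarrow> complex) \<Rightarrow> real) \<Rightarrow> bool" where
  "is_banach_fs V N \<longleftrightarrow>
     0 \<in> V \<and> (\<forall>f\<in>V. \<forall>g\<in>V. f + g \<in> V) \<and> (\<forall>c. \<forall>f\<in>V. csmul c f \<in> V) \<and>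
     (\<forall>f\<in>V. 0 \<le> N f) \<and> (\<forall>f\<in>V. N f = 0 \<longleftrightarrow> f = 0) \<and>
     (\<forall>f\<in>V. \<forall>g\<in>V. N (f + g) \<le> N f + N g) \<and>
     (\<forall>c. \<forall>f\<in>V. N (csmul c f) = cmod c * N f) \<and>
     (\<forall>fs. (\<forall>n. fs n \<in> V) \<and> (\<forall>e>0. \<exists>M::nat. \<forall>m\<ge>M. \<forall>n\<ge>M. N (fs m - fs n) < e)
           \<longrightarrow> (\<exists>f\<in>V. \<forall>e>0. \<exists>M::nat. \<forall>n\<ge>M. N (fs n - f) < e))"

definition unit_ball_fs :: "('b \<Rightarrow> complex) set \<Rightarrow> (('b \<Rightarrow> complex) \<Rightarrow> real) \<Rightarrow> ('b \<Rightarrow> complex) set" where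
  "unit_ball_fs V N = {f \<in> V. N f \<le> 1}"

text \<open>Bounded linear functionals on V (the dual space V*), made extensional
  (value 0 outside V) so that they are determined by their action on V.\<close>
definition dual_fs :: "('b \<Rightarrow> complex) set \<Rightarrow> (('b \<Rightarrow> complex) \<Rightarrow> real) \<Rightarrow> (('b \<Rightarrow> complex) \<Rightarrow> complex) set" where
  "dual_fs V N = {\<phi>.
     (\<forall>f\<in>V. \<forall>g\<in>V. \<phi> (f + g) = \<phi> f + \<phi> g) \<and>
     (\<forall>c. \<forall>f\<in>V. \<phi> (csmul c f) = c * \<phi> f) \<and>
     (\<exists>C. \<forall>f\<in>V. cmod (\<phi> f) \<le> C * N f) \<and>
     (\<forall>f. f \<notin> V \<longrightarrow> \<phi> f = 0)}"

definition dnorm_fs :: "('b \<Rightarrow> complex) set \<Rightarrow> (('b \<Rightarrow> complex) \<Rightarrow> real) \<Rightarrow> (('b \<Rightarrow> complex) \<Rightarrow> complex) \<Rightarrow> real" where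
  "dnorm_fs V N \<phi> = (SUP f \<in> unit_ball_fs V N. cmod (\<phi> f))"

definition norm_top_fs :: "('b \<Rightarrow> complex) set \<Rightarrow> (('b \<Rightarrow> complex) \<Rightarrow> real) \<Rightarrow> ('b \<Rightarrow> complex) topology" where
  "norm_top_fs V N = topology_generated_by {{g \<in> V. N (g - f) < r} | f r. f \<in> V}"

definition weak_top_fs :: "('b \<Rightarrow> complex) set \<Rightarrow> (('b \<Rightarrow> complex) \<Rightarrow> real) \<Rightarrow> ('b \<Rightarrow> complex) topology" where
  "weak_top_fs V N = topology_generated_by {{g \<in> V. \<psi> g \<in> U} | \<psi> U. \<psi> \<in> dual_fs V N \<and> open U}"

definition rel_compact_in :: "'a topology \<Rightarrow> 'a set \<Rightarrow> bool" where
  "rel_compact_in \<tau> S \<longleftrightarrow> compactin \<tau> (\<tau> closure_of S)"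

abbreviation disk :: "complex set" where "disk \<equiv> ball 0 1"

text \<open>H(D); functions are normalised to be 0 off the disk so that H(D) elements
  are identified with holomorphic functions on the disk.\<close>
definition Hol :: "(complex \<Rightarrow> complex) set" where
  "Hol = {f. f holomorphic_on disk \<and> (\<forall>z. z \<notin> disk \<longrightarrow> f z = 0)}"

definition uc_conv :: "(nat \<Rightarrow> complex \<Rightarrow> complex) \<Rightarrow> (complex \<Rightarrow> complex) \<Rightarrow> bool" where
  "uc_conv fs f \<longleftrightarrow> (\<forall>K. compact K \<and> K \<subseteq> disk \<longrightarrow> uniform_limit K fs f sequentially)"

definition linear_on_Hol :: "((complex \<Rightarrow> complex) \<Rightarrow> (complex \<Rightarrow> complex)) \<Rightarrow> bool" where
  "linear_on_Hol T \<longleftrightarrow> T ` Hol \<subseteq> Hol \<and>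
     (\<forall>f\<in>Hol. \<forall>g\<in>Hol. T (f + g) = T f + T g) \<and>
     (\<forall>c. \<forall>f\<in>Hol. T (csmul c f) = csmul c (T f))"

definition intrinsic :: "((complex \<Rightarrow> complex) \<Rightarrow> (complex \<Rightarrow> complex)) \<Rightarrow> bool" where
  "intrinsic T \<longleftrightarrow> linear_on_Hol T \<and>
     (\<forall>fs f. (\<forall>n. fs n \<in> Hol) \<and> f \<in> Hol \<and> uc_conv fs f
        \<longrightarrow> (\<exists>g\<in>Hol. uc_conv (\<lambda>n. T (fs n)) g))"

definition poly_on_disk :: "complex poly \<Rightarrow> (complex \<Rightarrow> complex)" where
  "poly_on_disk p = (\<lambda>z. if z \<in> disk then poly p z else 0)"

definition initial_space :: "(complex \<Rightarrow> complex) set \<Rightarrow> ((complex \<Rightarrow> complex) \<Rightarrow> real) \<Rightarrow> bool" where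
  "initial_space X N \<longleftrightarrow> X \<subseteq> Hol \<and> is_banach_fs X N \<and>
     (\<forall>p. poly_on_disk p \<in> X) \<and>
     (\<forall>fs. (\<forall>n. fs n \<in> unit_ball_fs X N) \<longrightarrow>
        (\<exists>(r::nat\<Rightarrow>nat) f. strict_mono r \<and> f \<in> X \<and> uc_conv (fs \<circ> r) f))"

definition typical_weight :: "(complex \<Rightarrow> real) \<Rightarrow> bool" where
  "typical_weight v \<longleftrightarrow> continuous_on disk v \<and>
     (\<forall>z\<in>disk. 0 < v z \<and> v z \<le> 1) \<and>
     (\<forall>z\<in>disk. \<forall>w\<in>disk. cmod z \<le> cmod w \<longrightarrow> v w \<le> v z) \<and>
     (\<forall>e>0. \<exists>r<1. \<forall>z\<in>disk. r < cmod z \<longrightarrow> v z < e)"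

text \<open>(radial follows from the non-increasing condition with |z| = |w|.)\<close>

definition Hv :: "(complex \<Rightarrow> real) \<Rightarrow> (complex \<Rightarrow> complex) set" where
  "Hv v = {f \<in> Hol. bdd_above ((\<lambda>z. v z * cmod (f z)) ` disk)}"

definition Hv_norm :: "(complex \<Rightarrow> real) \<Rightarrow> (complex \<Rightarrow> complex) \<Rightarrow> real" where
  "Hv_norm v f = (SUP z \<in> disk. v z * cmod (f z))"

definition Bv :: "(complex \<Rightarrow> real) \<Rightarrow> (complex \<Rightarrow> complex) set" where
  "Bv v = {f \<in> Hol. bdd_above ((\<lambda>z. v z * cmod (deriv f z)) ` disk)}"

definition Bv_norm :: "(complex \<Rightarrow> real) \<Rightarrow> (complex \<Rightarrow> complex) \<Rightarrow> real" where
  "Bv_norm v f = cmod (f 0) + (SUP z \<in> disk. v z * cmod (deriv f z))"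

definition KH :: "(complex \<Rightarrow> real) \<Rightarrow> complex \<Rightarrow> ((complex \<Rightarrow> complex) \<Rightarrow> complex)" where
  "KH v z = (\<lambda>g. if g \<in> Hv v then g z else 0)"

definition KB1 :: "(complex \<Rightarrow> real) \<Rightarrow> complex \<Rightarrow> ((complex \<Rightarrow> complex) \<Rightarrow> complex)" where
  "KB1 v z = (\<lambda>g. if g \<in> Bv v then deriv g z else 0)"

definition bounded_op :: "('a \<Rightarrow> complex) set \<Rightarrow> (('a \<Rightarrow> complex) \<Rightarrow> real) \<Rightarrow>
    ('b \<Rightarrow> complex) set \<Rightarrow> (('b \<Rightarrow> complex) \<Rightarrow> real) \<Rightarrow> (('a \<Rightarrow> complex) \<Rightarrow> ('b \<Rightarrow> complex)) \<Rightarrow> bool" where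
  "bounded_op X NX Y NY T \<longleftrightarrow> T ` X \<subseteq> Y \<and> (\<exists>C. \<forall>f\<in>X. NY (T f) \<le> C * NX f)"

definition compact_op :: "('a \<Rightarrow> complex) set \<Rightarrow> (('a \<Rightarrow> complex) \<Rightarrow> real) \<Rightarrow>
    ('b \<Rightarrow> complex) set \<Rightarrow> (('b \<Rightarrow> complex) \<Rightarrow> real) \<Rightarrow> (('a \<Rightarrow> complex) \<Rightarrow> ('b \<Rightarrow> complex)) \<Rightarrow> bool" where
  "compact_op X NX Y NY T \<longleftrightarrow> rel_compact_in (norm_top_fs Y NY) (T ` unit_ball_fs X NX)"

definition weakly_compact_op :: "('a \<Rightarrow> complex) set \<Rightarrow> (('a \<Rightarrow> complex) \<Rightarrow> real) \<Rightarrow>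
    ('b \<Rightarrow> complex) set \<Rightarrow> (('b \<Rightarrow> complex) \<Rightarrow> real) \<Rightarrow> (('a \<Rightarrow> complex) \<Rightarrow> ('b \<Rightarrow> complex)) \<Rightarrow> bool" where
  "weakly_compact_op X NX Y NY T \<longleftrightarrow> rel_compact_in (weak_top_fs Y NY) (T ` unit_ball_fs X NX)"

definition adjoint_op :: "('a \<Rightarrow> complex) set \<Rightarrow> (('a \<Rightarrow> complex) \<Rightarrow> ('b \<Rightarrow> complex)) \<Rightarrow>
    (('b \<Rightarrow> complex) \<Rightarrow> complex) \<Rightarrow> (('a \<Rightarrow> complex) \<Rightarrow> complex)" where
  "adjoint_op X T \<phi> = (\<lambda>f. if f \<in> X then \<phi> (T f) else 0)"

end

theory Submission
  imports Defs "HOL-Complex_Analysis.Complex_Analysis"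
begin

text \<open>
  The spaces \<open>H\<^sub>v\<close>, \<open>B\<^sub>v\<close> and \<open>X\<^sup>*\<close> all carry a norm given (up to equivalence) by the supremum over a family
  of functionals: weighted point evaluations, respectively evaluations at the unit ball of \<open>X\<close>.  The kernel
  \<open>k(f, z) = v(z) (T f)(z)\<close> on the product of the unit ball and the disk therefore describes both
  \<open>T\<close> on the unit ball and the set of functionals \<open>v(z) T\<^sup>* K\<^sub>z\<close>, and the two sides of the equivalence differ only by
  exchanging the roles of the two variables.

  For compactness this is the symmetry of total boundedness of a bounded kernel in its two variables.  For weak
  compactness, let \<open>W\<close> be the weakly compact closure on one side and \<open>Q\<close> the pointwise closure of the norming functionals
  there, which is compact by Banach--Alaoglu.  Every point of \<open>Q\<close> defines a limit row on the other side, and the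
  claim is that this map from \<open>Q\<close> is weakly continuous.  Weak separability of \<open>W\<close> reduces this to sequences, and a bounded
  sequence that tends to \<open>0\<close> under every functional in the pointwise closure of a norming family is weakly null: by
  Simons' greedy construction, suitable means of its absolute values are uniformly small on that compact set.  This last step
  replaces the Riesz representation theorem and the Hahn--Banach theorem.
\<close>

subsection \<open>Pointwise convergence and compactness\<close>

lemma continuous_on_apply [continuous_intros]: "continuous_on S (\<lambda>f :: 'a \<Rightarrow> 'b::topological_space. f x)"
  by (rule continuous_on_product_then_coordinatewise[OF continuous_on_id])

lemma tendsto_fun_iff:
  fixes f :: "'c \<Rightarrow> 'a \<Rightarrow> 'b::topological_space"
  shows "(f \<longlongrightarrow> l) F \<longleftrightarrow> (\<forall>x. ((\<lambda>i. f i x) \<longlongrightarrow> l x) F)"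
proof -
  have "limitin (product_topology (\<lambda>_. euclidean) UNIV) f l F \<longleftrightarrow> (\<forall>x. ((\<lambda>i. f i x) \<longlongrightarrow> l x) F)"
    by (simp add: limitin_componentwise)
  then show ?thesis
    by (simp add: euclidean_product_topology)
qed

lemma compact_box_fun:
  fixes B :: "'a \<Rightarrow> 'b::topological_space set"
  assumes "\<And>x. compact (B x)"
  shows "compact {f. \<forall>x. f x \<in> B x}"
proof -
  have "compactin (product_topology (\<lambda>_. euclidean) UNIV) (PiE UNIV B)"
    by (simp add: compactin_PiE assms)
  moreover have "PiE UNIV B = {f. \<forall>x. f x \<in> B x}"
    by auto
  ultimately show ?thesis
    by (simp add: euclidean_product_topology)
qed

lemma closure_fun_finite_approx:
  fixes u :: "'a \<Rightarrow> 'b::metric_space"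
  assumes "u \<in> closure S" and "finite F" and "e > 0"
  obtains f where "f \<in> S" and "\<And>x. x \<in> F \<Longrightarrow> dist (f x) (u x) < e"
proof -
  let ?U = "\<Inter>x\<in>F. {f. dist (f x) (u x) < e}"
  have "open ?U"
    by (intro open_INT assms(2) ballI open_Collect_less continuous_intros)
  moreover have "u \<in> ?U"
    using assms by simp
  ultimately obtain f where "f \<in> S" "f \<in> ?U"
    using assms(1) by (meson closure_iff_nhds_not_empty disjoint_iff subset_refl)
  then show ?thesis
    using that by auto
qed

lemma compactin_fip_family:
  assumes W: "compactin \<tau> W" and closed: "\<And>p. p \<in> P \<Longrightarrow> closedin \<tau> (C p)"
    and fip: "\<And>P'. \<lbrakk>finite P'; P' \<subseteq> P\<rbrakk> \<Longrightarrow> \<exists>y\<in>W. \<forall>p\<in>P'. y \<in> C p"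
  shows "\<exists>y\<in>W. \<forall>p\<in>P. y \<in> C p"
proof -
  have "W \<inter> \<Inter>(C ` P) \<noteq> {}"
  proof (rule compactin_fip[THEN iffD1, OF W, THEN conjunct2, rule_format], intro conjI ballI allI impI)
    fix \<F> assume "finite \<F> \<and> \<F> \<subseteq> C ` P"
    then obtain P' where P': "finite P'" "P' \<subseteq> P" "\<F> = C ` P'"
      using finite_subset_image[of \<F> C P] by auto
    then show "W \<inter> \<Inter>\<F> \<noteq> {}"
      using fip[OF P'(1,2)] by blast
  qed (use closed in auto)
  then show ?thesis
    by blast
qed

lemma compactin_finite_approx_attained:
  fixes h :: "'x \<Rightarrow> 'w \<Rightarrow> 'b::metric_space"
  assumes W: "compactin \<tau> W" and cont: "\<And>x. x \<in> A \<Longrightarrow> continuous_map \<tau> euclidean (h x)"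
    and approx: "\<And>F e. \<lbrakk>finite F; F \<subseteq> A; e > 0\<rbrakk> \<Longrightarrow> \<exists>y\<in>W. \<forall>x\<in>F. dist (h x y) (u x) < e"
  shows "\<exists>y\<in>W. \<forall>x\<in>A. h x y = u x"
proof -
  define C where "C p = {y \<in> topspace \<tau>. h (fst p) y \<in> cball (u (fst p)) (snd p)}" for p
  have "\<exists>y\<in>W. \<forall>p\<in>A \<times> {0::real<..}. y \<in> C p"
  proof (rule compactin_fip_family[OF W])
    show "closedin \<tau> (C p)" if "p \<in> A \<times> {0<..}" for p
      unfolding C_def using that by (intro closedin_continuous_map_preimage[OF cont]) auto
    fix P :: "('x \<times> real) set" assume P: "finite P" "P \<subseteq> A \<times> {0<..}"
    define e where "e = Min (insert 1 (snd ` P))"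
    have "e > 0"
      unfolding e_def using P by (subst Min_gr_iff) auto
    moreover have "fst ` P \<subseteq> A"
      using P(2) by auto
    ultimately obtain y where y: "y \<in> W" "\<And>x. x \<in> fst ` P \<Longrightarrow> dist (h x y) (u x) < e"
      using approx[of "fst ` P" e] P(1) by blast
    have "y \<in> C p" if "p \<in> P" for p
    proof -
      have "e \<le> snd p"
        unfolding e_def using P(1) that by (intro Min_le) auto
      moreover have "dist (h (fst p) y) (u (fst p)) < e"
        using y(2) that by blast
      ultimately show ?thesis
        using y(1) compactin_subset_topspace[OF W] by (auto simp: C_def dist_commute)
    qed
    with y(1) show "\<exists>y\<in>W. \<forall>p\<in>P. y \<in> C p"
      by blast
  qed
  then obtain y where "y \<in> W" and y: "\<And>x e. \<lbrakk>x \<in> A; e > 0\<rbrakk> \<Longrightarrow> y \<in> C (x, e)"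
    by auto
  have "h x y = u x" if "x \<in> A" for x
    using field_le_epsilon[of "dist (u x) (h x y)" 0] y[OF that] by (simp add: C_def)
  with \<open>y \<in> W\<close> show ?thesis
    by blast
qed

lemma compact_image_factor_tendsto:
  fixes \<epsilon> :: "'q::topological_space \<Rightarrow> 'm::t2_space" and h :: "'q \<Rightarrow> 'b::topological_space"
  assumes Q: "compact Q" and cont: "continuous_on Q \<epsilon>" "continuous_on Q h" and mem: "\<And>n. x n \<in> Q"
    and lim: "((\<lambda>n. \<epsilon> (x n)) \<longlongrightarrow> \<epsilon> q) F"
    and fibre: "\<And>q'. \<lbrakk>q' \<in> Q; \<epsilon> q' = \<epsilon> q\<rbrakk> \<Longrightarrow> h q' = h q"
  shows "((\<lambda>n. h (x n)) \<longlongrightarrow> h q) F"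
proof (rule topological_tendstoI)
  fix U assume "open U" "h q \<in> U"
  let ?Z = "Q \<inter> h -` (- U)"
  obtain A where "closed A" "?Z = Q \<inter> A"
    using cont(2) \<open>open U\<close> closed_Compl unfolding continuous_on_closed_invariant by (metis inf_commute)
  then have "closed (\<epsilon> ` ?Z)"
    using Q cont(1) by (intro compact_imp_closed compact_continuous_image) (auto simp: compact_Int_closed intro: continuous_on_subset)
  moreover have "\<epsilon> q \<notin> \<epsilon> ` ?Z"
    using fibre \<open>h q \<in> U\<close> by fastforce
  ultimately have "\<forall>\<^sub>F n in F. \<epsilon> (x n) \<in> - (\<epsilon> ` ?Z)"
    using lim by (auto simp: tendsto_def)
  then show "\<forall>\<^sub>F n in F. h (x n) \<in> U"
    by eventually_elim (use mem in auto)
qed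

lemma continuous_on_if_sequentially_along:
  fixes \<epsilon> :: "'q::topological_space \<Rightarrow> 'm::metric_space" and h :: "'q \<Rightarrow> 'b::topological_space"
  assumes \<epsilon>: "continuous_on Q \<epsilon>"
    and lim: "\<And>x q. \<lbrakk>\<And>n::nat. x n \<in> Q; q \<in> Q; (\<lambda>n. \<epsilon> (x n)) \<longlonglongrightarrow> \<epsilon> q\<rbrakk> \<Longrightarrow> (\<lambda>n. h (x n)) \<longlonglongrightarrow> h q"
  shows "continuous_on Q h"
  unfolding continuous_on_def
proof (intro ballI topological_tendstoI)
  fix q U assume q: "q \<in> Q" and U: "open U" "h q \<in> U"
  have "\<exists>e>0. \<forall>x\<in>Q. dist (\<epsilon> x) (\<epsilon> q) < e \<longrightarrow> h x \<in> U"
  proof (rule ccontr)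
    assume "\<not> ?thesis"
    then have "\<forall>n. \<exists>x\<in>Q. dist (\<epsilon> x) (\<epsilon> q) < 1 / real (Suc n) \<and> h x \<notin> U"
      by (meson of_nat_0_less_iff zero_less_Suc zero_less_divide_1_iff)
    then obtain x where x: "\<And>n. x n \<in> Q" "\<And>n. dist (\<epsilon> (x n)) (\<epsilon> q) < 1 / real (Suc n)" "\<And>n. h (x n) \<notin> U"
      by metis
    have "(\<lambda>n. \<epsilon> (x n)) \<longlonglongrightarrow> \<epsilon> q"
    proof (rule metric_tendsto_imp_tendsto)
      show "(\<lambda>n. 1 / real (Suc n)) \<longlonglongrightarrow> 0"
        using LIMSEQ_inverse_real_of_nat by (simp only: inverse_eq_divide)
      show "\<forall>\<^sub>F n in sequentially. dist (\<epsilon> (x n)) (\<epsilon> q) \<le> dist (1 / real (Suc n)) 0"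
        using x(2) by (intro always_eventually allI less_imp_le) (simp del: of_nat_Suc)
    qed
    from lim[OF x(1) q this] have "\<forall>\<^sub>F n in sequentially. h (x n) \<in> U"
      using U by (auto simp: tendsto_def)
    then show False
      using x(3) by simp
  qed
  then obtain e where "e > 0" and e: "\<And>x. \<lbrakk>x \<in> Q; dist (\<epsilon> x) (\<epsilon> q) < e\<rbrakk> \<Longrightarrow> h x \<in> U"
    by blast
  have "\<forall>\<^sub>F x in at q within Q. dist (\<epsilon> x) (\<epsilon> q) < e"
    using \<epsilon> q \<open>e > 0\<close> by (auto simp: continuous_on_def intro: tendstoD)
  moreover have "\<forall>\<^sub>F x in at q within Q. x \<in> Q"
    by (simp add: eventually_at_filter)
  ultimately show "\<forall>\<^sub>F x in at q within Q. h x \<in> U"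
    by eventually_elim (use e in blast)
qed

lemma not_null_imp_large_subseq:
  fixes x :: "nat \<Rightarrow> 'a::real_normed_vector"
  assumes "\<not> x \<longlonglongrightarrow> 0"
  shows "\<exists>\<delta> r. \<delta> > 0 \<and> strict_mono (r :: nat \<Rightarrow> nat) \<and> (\<forall>n. \<delta> \<le> norm (x (r n)))"
proof -
  obtain \<delta> where "\<delta> > 0" and "\<forall>M. \<exists>n\<ge>M. \<delta> \<le> norm (x n)"
    using assms unfolding LIMSEQ_iff by (auto simp: not_less)
  then have "infinite {n. \<delta> \<le> norm (x n)}"
    unfolding infinite_nat_iff_unbounded_le by auto
  then show ?thesis
    using infinite_enumerate[of "{n. \<delta> \<le> norm (x n)}"] \<open>\<delta> > 0\<close> by auto
qed

lemma rel_compact_in_subset_compactin: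
  assumes "Hausdorff_space \<tau>" and "compactin \<tau> C" and "S \<subseteq> C"
  shows "rel_compact_in \<tau> S"
  unfolding rel_compact_in_def
  by (meson assms closed_compactin closedin_closure_of closure_of_minimal compactin_imp_closedin)

lemma rel_compact_in_insert_iff:
  assumes "Hausdorff_space \<tau>" and "x \<in> topspace \<tau>" and "S \<subseteq> topspace \<tau>"
  shows "rel_compact_in \<tau> (insert x S) \<longleftrightarrow> rel_compact_in \<tau> S"
proof
  assume "rel_compact_in \<tau> (insert x S)"
  then have "compactin \<tau> (\<tau> closure_of insert x S)"
    by (simp add: rel_compact_in_def)
  moreover have "S \<subseteq> \<tau> closure_of insert x S"
    using closure_of_subset[of "insert x S" \<tau>] assms by simp
  ultimately show "rel_compact_in \<tau> S"
    by (rule rel_compact_in_subset_compactin[OF assms(1)])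
next
  assume "rel_compact_in \<tau> S"
  then have "compactin \<tau> ({x} \<union> \<tau> closure_of S)"
    using assms by (intro compactin_Un) (simp_all add: rel_compact_in_def)
  moreover have "insert x S \<subseteq> {x} \<union> \<tau> closure_of S"
    using closure_of_subset[OF assms(3)] by auto
  ultimately show "rel_compact_in \<tau> (insert x S)"
    by (rule rel_compact_in_subset_compactin[OF assms(1)])
qed

subsection \<open>Small midpoint means of pointwise null sequences\<close>

inductive_set midpoint_hull :: "('q \<Rightarrow> real) set \<Rightarrow> ('q \<Rightarrow> real) set" for F where
  base: "f \<in> F \<Longrightarrow> f \<in> midpoint_hull F"
| midpoint: "\<lbrakk>f \<in> midpoint_hull F; g \<in> midpoint_hull F\<rbrakk> \<Longrightarrow> (\<lambda>q. (f q + g q) / 2) \<in> midpoint_hull F"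

lemma midpoint_hull_mono:
  assumes "F \<subseteq> G"
  shows "midpoint_hull F \<subseteq> midpoint_hull G"
proof
  fix h assume "h \<in> midpoint_hull F"
  then show "h \<in> midpoint_hull G"
    by induction (use assms in \<open>auto intro: midpoint_hull.intros\<close>)
qed

lemma midpoint_hull_le:
  assumes "h \<in> midpoint_hull F" and "\<And>f. f \<in> F \<Longrightarrow> f q \<le> a"
  shows "h q \<le> a"
  using assms(1) by induction (use assms(2) in auto)

lemma midpoint_hull_ge:
  assumes "h \<in> midpoint_hull F" and "\<And>f. f \<in> F \<Longrightarrow> a \<le> f q"
  shows "a \<le> h q"
  using assms(1) by induction (use assms(2) in auto)

lemma continuous_on_midpoint_hull:
  fixes F :: "('q::topological_space \<Rightarrow> real) set"
  assumes "h \<in> midpoint_hull F" and "\<And>f. f \<in> F \<Longrightarrow> continuous_on Q f"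
  shows "continuous_on Q h"
  using assms(1) by induction (use assms(2) in \<open>auto intro!: continuous_intros\<close>)

lemma add_divide_power_Suc: "a + b / 2 ^ Suc n + c / 2 ^ Suc n = a + (b + c) / 2 / 2 ^ n" for a b c :: real
  by (simp add: field_simps)

locale decreasing_midpoint_convex =
  fixes H :: "nat \<Rightarrow> ('q::topological_space \<Rightarrow> real) set" and Q :: "'q set" and B :: real
  assumes nonempty: "H n \<noteq> {}"
    and decreasing: "H (Suc n) \<subseteq> H n"
    and midpoint: "\<lbrakk>f \<in> H n; g \<in> H n\<rbrakk> \<Longrightarrow> (\<lambda>q. (f q + g q) / 2) \<in> H n"
    and compact_domain: "compact Q" and domain_nonempty: "Q \<noteq> {}"
    and continuous: "h \<in> H 0 \<Longrightarrow> continuous_on Q h"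
    and nonneg: "\<lbrakk>h \<in> H 0; q \<in> Q\<rbrakk> \<Longrightarrow> 0 \<le> h q"
    and bounded: "\<lbrakk>h \<in> H 0; q \<in> Q\<rbrakk> \<Longrightarrow> h q \<le> B"
begin

lemma subset_H0: "H n \<subseteq> H 0"
  using decreasing by (induction n) auto

lemma SUP_upper_H0:
  assumes "h \<in> H 0" "q \<in> Q"
  shows "h q \<le> (SUP q\<in>Q. h q)"
  using assms bounded by (intro cSUP_upper bdd_aboveI2[of _ _ B])

lemma SUP_H0_nonneg:
  assumes "h \<in> H 0"
  shows "0 \<le> (SUP q\<in>Q. h q)"
  using domain_nonempty nonneg[OF assms] SUP_upper_H0[OF assms] by (meson ex_in_conv order_trans)

lemma midpoint_Suc: "\<lbrakk>y \<in> H n; h \<in> H (Suc n)\<rbrakk> \<Longrightarrow> (\<lambda>q. (y q + h q) / 2) \<in> H n"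
  using midpoint[of y n h] decreasing[of n] by auto

definition admissible :: "nat \<Rightarrow> ('q \<Rightarrow> real) \<Rightarrow> bool" where
  "admissible n z \<longleftrightarrow> (\<forall>h\<in>H n. (\<lambda>q. z q + h q / 2 ^ n) \<in> H 0)"

text \<open>For the partial sum \<open>z = (\<Sum>k<n. y k / 2 ^ Suc k)\<close>, the weight \<open>2 ^ -n\<close> of the next vector \<open>y\<close> is the total
  weight of all later terms.\<close>
definition greedy_step :: "real \<Rightarrow> nat \<Rightarrow> ('q \<Rightarrow> real) \<Rightarrow> ('q \<Rightarrow> real) \<Rightarrow> bool" where
  "greedy_step e n z y \<longleftrightarrow> y \<in> H n \<and>
    (\<forall>h\<in>H n. (SUP q\<in>Q. z q + y q / 2 ^ n) \<le> (SUP q\<in>Q. z q + h q / 2 ^ n) + e / 4 ^ n)"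

lemma ex_greedy_step:
  assumes "e > 0" and "admissible n z"
  shows "\<exists>y. greedy_step e n z y"
proof -
  let ?S = "\<lambda>h. SUP q\<in>Q. z q + h q / 2 ^ n"
  have bdd: "bdd_below (?S ` H n)"
    using assms(2) SUP_H0_nonneg unfolding admissible_def by (intro bdd_belowI2[of _ 0]) blast
  have "(INF h\<in>H n. ?S h) < (INF h\<in>H n. ?S h) + e / 4 ^ n"
    using assms(1) by simp
  then obtain y where "y \<in> H n" "?S y < (INF h\<in>H n. ?S h) + e / 4 ^ n"
    using nonempty by (subst (asm) cINF_less_iff[OF _ bdd]) auto
  then show ?thesis
    using cINF_lower[OF bdd] unfolding greedy_step_def by (intro exI[of _ y]) fastforce
qed

lemma admissible_Suc:
  assumes "admissible n z" and "y \<in> H n"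
  shows "admissible (Suc n) (\<lambda>q. z q + y q / 2 ^ Suc n)"
  unfolding admissible_def
proof
  fix h assume "h \<in> H (Suc n)"
  from midpoint_Suc[OF assms(2) this] show "(\<lambda>q. z q + y q / 2 ^ Suc n + h q / 2 ^ Suc n) \<in> H 0"
    using assms(1) by (simp only: admissible_def add_divide_power_Suc)
qed

lemma greedy_sequence:
  assumes "e > 0"
  obtains z y where "z 0 = (\<lambda>_. 0)" "\<And>n. z (Suc n) = (\<lambda>q. z n q + y n q / 2 ^ Suc n)"
    "\<And>n. greedy_step e n (z n) (y n)"
proof -
  have "\<exists>z. \<forall>n. (admissible n (z n) \<and> (n = 0 \<longrightarrow> z n = (\<lambda>_. 0))) \<and>
      (\<exists>y. greedy_step e n (z n) y \<and> z (Suc n) = (\<lambda>q. z n q + y q / 2 ^ Suc n))"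
  proof (rule dependent_nat_choice)
    show "\<exists>z. admissible 0 z \<and> (0 = 0 \<longrightarrow> z = (\<lambda>_. 0))"
      by (simp add: admissible_def)
    fix z n assume z: "admissible n z \<and> (n = 0 \<longrightarrow> z = (\<lambda>_. 0))"
    then obtain y where y: "greedy_step e n z y"
      using ex_greedy_step[OF assms] by blast
    then have "admissible (Suc n) (\<lambda>q. z q + y q / 2 ^ Suc n)"
      using z admissible_Suc by (simp only: greedy_step_def)
    with y show "\<exists>z'. (admissible (Suc n) z' \<and> (Suc n = 0 \<longrightarrow> z' = (\<lambda>_. 0))) \<and>
        (\<exists>y. greedy_step e n z y \<and> z' = (\<lambda>q. z q + y q / 2 ^ Suc n))"
      by (intro exI conjI) auto
  qed
  then obtain z where z: "z 0 = (\<lambda>_. 0)"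
    "\<forall>n. \<exists>y. greedy_step e n (z n) y \<and> z (Suc n) = (\<lambda>q. z n q + y q / 2 ^ Suc n)"
    by blast
  from choice[OF z(2)] z(1) show ?thesis
    using that by blast
qed

end

locale greedy_run = decreasing_midpoint_convex H Q B
  for H :: "nat \<Rightarrow> ('q::topological_space \<Rightarrow> real) set" and Q and B +
  fixes e :: real and z y :: "nat \<Rightarrow> 'q \<Rightarrow> real"
  assumes e_pos: "e > 0"
    and z_0: "z 0 = (\<lambda>_. 0)" and z_Suc: "z (Suc n) = (\<lambda>q. z n q + y n q / 2 ^ Suc n)"
    and greedy: "greedy_step e n (z n) (y n)"
begin

definition mean :: "nat \<Rightarrow> 'q \<Rightarrow> real" where
  "mean n = (\<lambda>q. z n q + y n q / 2 ^ n)"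

lemma y_in_H: "y n \<in> H n"
  using greedy by (simp add: greedy_step_def)

lemma tail_in_H:
  assumes "h \<in> H (n + k)"
  shows "\<exists>d\<in>H n. (\<lambda>q. z (n + k) q + h q / 2 ^ (n + k)) = (\<lambda>q. z n q + d q / 2 ^ n)"
  using assms
proof (induction k arbitrary: h)
  case (Suc k)
  let ?h = "\<lambda>q. (y (n + k) q + h q) / 2"
  have "h \<in> H (Suc (n + k))"
    using Suc.prems by simp
  from midpoint_Suc[OF y_in_H this] have "?h \<in> H (n + k)" .
  moreover have "z (n + Suc k) q + h q / 2 ^ (n + Suc k) = z (n + k) q + ?h q / 2 ^ (n + k)" for q
    by (simp only: z_Suc add_Suc_right add_divide_power_Suc)
  ultimately show ?case
    using Suc.IH by (simp only:)
qed auto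

lemma later_mean: "\<exists>d\<in>H n. mean (n + k) = (\<lambda>q. z n q + d q / 2 ^ n)"
  unfolding mean_def by (rule tail_in_H[OF y_in_H])

lemma mean_in_H0: "mean n \<in> H 0"
  using later_mean[of 0 n] z_0 by auto

lemma uniformly_convergent_mean: "uniformly_convergent_on Q mean"
proof (intro Cauchy_uniformly_convergent uniformly_Cauchy_onI')
  fix r :: real assume "r > 0"
  have close: "dist (mean n q) (mean (n + k) q) \<le> B * (1/2) ^ n" if "q \<in> Q" for q n k
  proof -
    obtain d where "d \<in> H n" "mean (n + k) = (\<lambda>q. z n q + d q / 2 ^ n)"
      using later_mean by blast
    moreover have "\<bar>y n q - d q\<bar> \<le> B" if "d \<in> H n" for d
      using that y_in_H[of n] subset_H0[of n] nonneg[of _ q] bounded[of _ q] \<open>q \<in> Q\<close> by (smt (verit) subsetD)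
    ultimately show ?thesis
      by (simp add: dist_real_def mean_def power_one_over divide_right_mono flip: diff_divide_distrib)
  qed
  have "(\<lambda>n. B * (1/2) ^ n) \<longlonglongrightarrow> 0"
    by (intro tendsto_mult_right_zero LIMSEQ_power_zero) simp
  then have "\<forall>\<^sub>F n in sequentially. B * (1/2) ^ n < r"
    using \<open>r > 0\<close> by (rule order_tendstoD)
  then obtain M where "\<And>n. n \<ge> M \<Longrightarrow> B * (1/2) ^ n < r"
    by (auto simp: eventually_sequentially)
  then have "dist (mean m q) (mean n q) < r" if "q \<in> Q" "m \<ge> M" "n > m" for q m n
    using close[of q m "n - m"] that by fastforce
  then show "\<exists>M. \<forall>q\<in>Q. \<forall>m\<ge>M. \<forall>n>m. dist (mean m q) (mean n q) < r"
    by blast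
qed

lemma SUP_mean_le:
  assumes w: "uniform_limit Q mean w sequentially" and p: "\<And>q. q \<in> Q \<Longrightarrow> w q \<le> w p"
  shows "(SUP q\<in>Q. mean n q) \<le> w p + e / 4 ^ n"
proof (rule field_le_epsilon)
  fix r :: real assume "r > 0"
  then obtain M where M: "\<And>m q. \<lbrakk>m \<ge> M; q \<in> Q\<rbrakk> \<Longrightarrow> dist (mean m q) (w q) < r"
    using uniform_limitD[OF w, of r] by (auto simp: eventually_sequentially)
  obtain d where "d \<in> H n" and d: "mean (n + M) = (\<lambda>q. z n q + d q / 2 ^ n)"
    using later_mean by blast
  have "(SUP q\<in>Q. mean n q) \<le> (SUP q\<in>Q. mean (n + M) q) + e / 4 ^ n"
    using greedy[of n] \<open>d \<in> H n\<close> by (simp add: greedy_step_def mean_def[of n] d)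
  moreover have "(SUP q\<in>Q. mean (n + M) q) \<le> w p + r"
    using M[of "n + M"] p by (intro cSUP_least domain_nonempty) (fastforce simp: dist_real_def)
  ultimately show "(SUP q\<in>Q. mean n q) \<le> w p + e / 4 ^ n + r"
    by simp
qed

lemma z_le:
  assumes "q \<in> Q" and mean_le: "\<And>n. mean n q \<le> m + e / 4 ^ n"
  shows "z n q \<le> m - (m - 2 * e) / 2 ^ n - 2 * e / 4 ^ n"
proof (induction n)
  case (Suc n)
  have "z (Suc n) q = (z n q + mean n q) / 2"
    by (simp add: z_Suc mean_def field_simps)
  also have "\<dots> \<le> (m - (m - 2 * e) / 2 ^ n - 2 * e / 4 ^ n + (m + e / 4 ^ n)) / 2"
    using Suc mean_le by (intro divide_right_mono add_mono) auto
  also have "\<dots> = m - (m - 2 * e) / 2 ^ Suc n - 2 * e / 4 ^ Suc n"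
    by (simp add: field_simps)
  finally show ?case .
qed (simp add: z_0)

lemma large_at_maximum:
  assumes w: "uniform_limit Q mean w sequentially" and p: "p \<in> Q" "\<And>q. q \<in> Q \<Longrightarrow> w q \<le> w p"
    and large: "3 * e \<le> w p"
  shows "\<exists>h\<in>H n. e < h p"
proof -
  have "mean n p \<le> w p + e / 4 ^ n" for n
    using SUP_upper_H0[OF mean_in_H0 p(1)] SUP_mean_le[OF w p(2)] order_trans by blast
  then have "z n p \<le> w p - (w p - 2 * e) / 2 ^ n - 2 * e / 4 ^ n"
    by (rule z_le[OF p(1)])
  moreover have "e / 2 ^ n \<le> (w p - 2 * e) / 2 ^ n" "0 < 2 * e / 4 ^ n"
    using large e_pos by (auto intro: divide_right_mono)
  ultimately have "z n p + e / 2 ^ n < w p"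
    by linarith
  then obtain M where M: "\<And>m. m \<ge> M \<Longrightarrow> z n p + e / 2 ^ n < mean m p"
    using order_tendstoD(1)[OF tendsto_uniform_limitI[OF w p(1)]] by (auto simp: eventually_sequentially)
  obtain d where "d \<in> H n" and "mean (n + M) = (\<lambda>q. z n q + d q / 2 ^ n)"
    using later_mean by blast
  then show ?thesis
    using M[of "n + M"] by (intro bexI[of _ d]) (auto simp: divide_less_cancel)
qed

end

text \<open>The heart of Simons' inequality; the point is a maximum point of the limit of the greedy means.\<close>
lemma (in decreasing_midpoint_convex) common_large_point:
  assumes "e > 0" and large: "\<And>h. h \<in> H 0 \<Longrightarrow> 4 * e \<le> (SUP q\<in>Q. h q)"
  obtains q where "q \<in> Q" "\<And>n. \<exists>h\<in>H n. e < h q"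
proof -
  obtain z y where "z 0 = (\<lambda>_. 0)" "\<And>n. z (Suc n) = (\<lambda>q. z n q + y n q / 2 ^ Suc n)"
    "\<And>n. greedy_step e n (z n) (y n)"
    using greedy_sequence[OF \<open>e > 0\<close>] by blast
  then interpret greedy_run H Q B e z y
    using \<open>e > 0\<close> by unfold_locales
  obtain w where w: "uniform_limit Q mean w sequentially"
    using uniformly_convergent_mean by (auto simp: uniformly_convergent_on_def)
  have "continuous_on Q w"
    using uniform_limit_theorem[OF _ w] continuous mean_in_H0 by simp
  then obtain p where p: "p \<in> Q" "\<And>q. q \<in> Q \<Longrightarrow> w q \<le> w p"
    using continuous_attains_sup[OF compact_domain domain_nonempty] by blast
  have "3 * e \<le> w p"
    using order_trans[OF large[OF mean_in_H0] SUP_mean_le[OF w p(2)], of 0] by simp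
  then show ?thesis
    using that[OF p(1)] large_at_maximum[OF w p] by blast
qed

theorem pointwise_null_imp_midpoint_mean_small:
  fixes f :: "nat \<Rightarrow> 'q::topological_space \<Rightarrow> real"
  assumes "compact Q" and cont: "\<And>n. continuous_on Q (f n)"
    and range: "\<And>n q. q \<in> Q \<Longrightarrow> f n q \<in> {0..B}"
    and null: "\<And>q. q \<in> Q \<Longrightarrow> (\<lambda>n. f n q) \<longlonglongrightarrow> 0" and "e > 0"
  shows "\<exists>h\<in>midpoint_hull (range f). \<forall>q\<in>Q. h q < e"
proof (rule ccontr)
  assume contr: "\<not> ?thesis"
  define H where "H n = midpoint_hull (f ` {n..})" for n
  have range_H: "h q \<in> {0..B}" if "h \<in> H n" "q \<in> Q" for h n q
    using that midpoint_hull_le[of h "f ` {n..}" q B] midpoint_hull_ge[of h "f ` {n..}" 0 q] range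
    by (auto simp: H_def)
  have H_0: "H 0 = midpoint_hull (range f)"
    by (simp add: H_def)
  have "Q \<noteq> {}"
    using contr midpoint_hull.base[of "f 0" "range f"] by blast
  interpret decreasing_midpoint_convex H Q B
  proof
    show "H n \<noteq> {}" for n
      using midpoint_hull.base[of "f n" "f ` {n..}"] by (auto simp: H_def)
    show "H (Suc n) \<subseteq> H n" for n
      unfolding H_def by (intro midpoint_hull_mono) auto
    show "continuous_on Q h" if "h \<in> H 0" for h
      using that cont by (intro continuous_on_midpoint_hull[of h]) (auto simp: H_def)
    show "(\<lambda>q. (f q + g q) / 2) \<in> H n" if "f \<in> H n" "g \<in> H n" for f g n
      using that unfolding H_def by (rule midpoint_hull.midpoint)
  qed (use range_H[of _ 0] \<open>compact Q\<close> \<open>Q \<noteq> {}\<close> in auto)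
  have "e \<le> (SUP q\<in>Q. h q)" if "h \<in> H 0" for h
    using contr that SUP_upper_H0[OF that] unfolding H_0 by (meson not_less order_trans)
  then obtain q where q: "q \<in> Q" "\<And>n. \<exists>h\<in>H n. e / 4 < h q"
    using common_large_point[of "e / 4"] \<open>e > 0\<close> by auto
  obtain n where n: "\<And>k. k \<ge> n \<Longrightarrow> f k q < e / 4"
    using order_tendstoD(2)[OF null[OF q(1)], of "e / 4"] \<open>e > 0\<close> by (auto simp: eventually_sequentially)
  have "h q \<le> e / 4" if "h \<in> H n" for h
    using that n midpoint_hull_le[of h "f ` {n..}" q "e / 4"] by (auto simp: H_def intro: less_imp_le)
  then show False
    using q(2)[of n] by force
qed

subsection \<open>Bounded functionals on normed spaces of functions\<close>

lemma csmul_apply [simp]: "csmul c f x = c * f x"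
  by (simp add: csmul_def)

lemma diff_eq_add_csmul: "f - g = f + csmul (-1) g"
  by (auto simp: fun_eq_iff)

lemma dual_fs_zero_outside: "\<lbrakk>\<phi> \<in> dual_fs V N; f \<notin> V\<rbrakk> \<Longrightarrow> \<phi> f = 0"
  and dual_fs_add: "\<lbrakk>\<phi> \<in> dual_fs V N; f \<in> V; g \<in> V\<rbrakk> \<Longrightarrow> \<phi> (f + g) = \<phi> f + \<phi> g"
  and dual_fs_csmul: "\<lbrakk>\<phi> \<in> dual_fs V N; f \<in> V\<rbrakk> \<Longrightarrow> \<phi> (csmul c f) = c * \<phi> f"
  by (simp_all add: dual_fs_def)

definition dual_ball_fs :: "('b \<Rightarrow> complex) set \<Rightarrow> (('b \<Rightarrow> complex) \<Rightarrow> real) \<Rightarrow> real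
    \<Rightarrow> (('b \<Rightarrow> complex) \<Rightarrow> complex) set" where
  "dual_ball_fs V N r = {\<phi> \<in> dual_fs V N. \<forall>f\<in>V. cmod (\<phi> f) \<le> r * N f}"

lemma dual_ball_fsI:
  assumes "\<And>f g. \<lbrakk>f \<in> V; g \<in> V\<rbrakk> \<Longrightarrow> \<phi> (f + g) = \<phi> f + \<phi> g"
    and "\<And>c f. f \<in> V \<Longrightarrow> \<phi> (csmul c f) = c * \<phi> f"
    and "\<And>f. f \<in> V \<Longrightarrow> cmod (\<phi> f) \<le> r * N f"
    and "\<And>f. f \<notin> V \<Longrightarrow> \<phi> f = 0"
  shows "\<phi> \<in> dual_ball_fs V N r"
  using assms unfolding dual_ball_fs_def dual_fs_def by blast

lemma dual_ball_fs_subset: "dual_ball_fs V N r \<subseteq> dual_fs V N"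
  by (auto simp: dual_ball_fs_def)

lemma dual_ball_fs_le: "\<lbrakk>\<phi> \<in> dual_ball_fs V N r; f \<in> V\<rbrakk> \<Longrightarrow> cmod (\<phi> f) \<le> r * N f"
  by (simp add: dual_ball_fs_def)

lemma
  shows compact_dual_ball_fs: "compact (dual_ball_fs V N r)"
    and closed_dual_ball_fs: "closed (dual_ball_fs V N r)"
proof -
  define box where "box = {\<phi>. \<forall>f. \<phi> f \<in> cball (0::complex) (if f \<in> V then r * N f else 0)}"
  define lin where "lin = (\<Inter>f\<in>V. \<Inter>g\<in>V. {\<phi> :: ('a \<Rightarrow> complex) \<Rightarrow> complex. \<phi> (f + g) = \<phi> f + \<phi> g})
    \<inter> (\<Inter>c. \<Inter>f\<in>V. {\<phi> :: ('a \<Rightarrow> complex) \<Rightarrow> complex. \<phi> (csmul c f) = c * \<phi> f})"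
  have eq: "dual_ball_fs V N r = box \<inter> lin"
  proof
    show "dual_ball_fs V N r \<subseteq> box \<inter> lin"
      by (auto simp: dual_ball_fs_def dual_fs_def box_def lin_def)
    show "box \<inter> lin \<subseteq> dual_ball_fs V N r"
    proof
      fix \<phi> assume \<phi>: "\<phi> \<in> box \<inter> lin"
      then have "cmod (\<phi> f) \<le> (if f \<in> V then r * N f else 0)" for f
        by (simp add: box_def)
      then have "f \<in> V \<Longrightarrow> cmod (\<phi> f) \<le> r * N f" and "f \<notin> V \<Longrightarrow> \<phi> f = 0" for f
        by (metis (full_types), metis norm_le_zero_iff)
      then show "\<phi> \<in> dual_ball_fs V N r"
        using \<phi> by (intro dual_ball_fsI) (auto simp: lin_def)
    qed
  qed
  have "closed lin"
    unfolding lin_def by (intro closed_Int closed_INT ballI closed_Collect_eq continuous_intros)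
  moreover have "closed box"
    unfolding box_def mem_cball by (intro closed_Collect_all closed_Collect_le continuous_intros)
  moreover have "compact box"
    unfolding box_def by (rule compact_box_fun) simp
  ultimately show "compact (dual_ball_fs V N r)" "closed (dual_ball_fs V N r)"
    unfolding eq by (auto intro: compact_Int_closed)
qed

locale normed_fs =
  fixes V :: "('a \<Rightarrow> complex) set" and N :: "('a \<Rightarrow> complex) \<Rightarrow> real"
  assumes zero_mem: "0 \<in> V"
    and add_mem: "\<lbrakk>f \<in> V; g \<in> V\<rbrakk> \<Longrightarrow> f + g \<in> V"
    and csmul_mem: "f \<in> V \<Longrightarrow> csmul c f \<in> V"
    and norm_triangle: "\<lbrakk>f \<in> V; g \<in> V\<rbrakk> \<Longrightarrow> N (f + g) \<le> N f + N g"
    and norm_csmul_le: "f \<in> V \<Longrightarrow> N (csmul c f) \<le> cmod c * N f"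
    and norm_eq_0: "\<lbrakk>f \<in> V; N f = 0\<rbrakk> \<Longrightarrow> f = 0"
begin

lemma diff_mem: "\<lbrakk>f \<in> V; g \<in> V\<rbrakk> \<Longrightarrow> f - g \<in> V"
  by (simp add: diff_eq_add_csmul add_mem csmul_mem)

lemma norm_zero: "N 0 = 0"
proof (rule antisym)
  have "csmul 0 0 = (0 :: 'a \<Rightarrow> complex)"
    by (auto simp: fun_eq_iff)
  then show "N 0 \<le> 0"
    using norm_csmul_le[OF zero_mem, of 0] by simp
  show "0 \<le> N 0"
    using norm_triangle[OF zero_mem zero_mem] by simp
qed

lemma norm_nonneg:
  assumes "f \<in> V"
  shows "0 \<le> N f"
  using norm_triangle[OF assms csmul_mem[OF assms, of "-1"]] norm_csmul_le[OF assms, of "-1"] norm_zero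
  by (simp flip: diff_eq_add_csmul)

lemma norm_csmul:
  assumes "f \<in> V"
  shows "N (csmul c f) = cmod c * N f"
proof (cases "c = 0")
  case True
  then show ?thesis
    using norm_csmul_le[OF assms, of c] norm_nonneg[OF csmul_mem[OF assms, of c]] by simp
next
  case False
  have "csmul (1 / c) (csmul c f) = f"
    using False by (auto simp: fun_eq_iff)
  then have "cmod c * N f \<le> N (csmul c f)"
    using norm_csmul_le[OF csmul_mem[OF assms], of "1 / c" c] False by (simp add: norm_divide field_simps)
  then show ?thesis
    using norm_csmul_le[OF assms] by (simp add: order_antisym)
qed

lemma norm_minus_commute:
  assumes "f \<in> V" "g \<in> V"
  shows "N (f - g) = N (g - f)"
proof -
  have "f - g = csmul (-1) (g - f)"
    by (auto simp: fun_eq_iff)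
  then show ?thesis
    using norm_csmul[OF diff_mem[OF assms(2,1)], of "-1"] by simp
qed

lemma norm_diff_triangle:
  assumes "f \<in> V" "g \<in> V" "h \<in> V"
  shows "N (f - h) \<le> N (f - g) + N (g - h)"
  using norm_triangle[OF diff_mem[OF assms(1,2)] diff_mem[OF assms(2,3)]] by simp

lemma dual_fs_diff: "\<lbrakk>\<phi> \<in> dual_fs V N; f \<in> V; g \<in> V\<rbrakk> \<Longrightarrow> \<phi> (f - g) = \<phi> f - \<phi> g"
  by (simp add: diff_eq_add_csmul dual_fs_add dual_fs_csmul csmul_mem)

lemma dual_fs_in_dual_ball:
  assumes "\<phi> \<in> dual_fs V N"
  obtains r where "r > 0" "\<phi> \<in> dual_ball_fs V N r"
proof -
  obtain D where D: "\<And>f. f \<in> V \<Longrightarrow> cmod (\<phi> f) \<le> D * N f"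
    using assms unfolding dual_fs_def by blast
  have "cmod (\<phi> f) \<le> max D 1 * N f" if "f \<in> V" for f
    using D[OF that] mult_right_mono[of D "max D 1" "N f"] norm_nonneg[OF that] by simp
  then show ?thesis
    using that[of "max D 1"] assms by (simp add: dual_ball_fs_def)
qed

end

lemma is_banach_fs_imp_normed_fs:
  assumes "is_banach_fs V N"
  shows "normed_fs V N"
  using assms unfolding is_banach_fs_def by unfold_locales auto

subsection \<open>Weak and norm topologies\<close>

lemma topspace_weak_top_fs [simp]: "topspace (weak_top_fs V N) = V"
proof -
  have "(\<lambda>_. 0) \<in> dual_fs V N"
    unfolding dual_fs_def by (auto intro: exI[of _ 0])
  then have "{g \<in> V. (\<lambda>_. 0) g \<in> (UNIV :: complex set)} \<in> {{g \<in> V. \<psi> g \<in> U} |\<psi> U. \<psi> \<in> dual_fs V N \<and> open U}"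
    by blast
  then show ?thesis
    unfolding weak_top_fs_def topology_generated_by_topspace by blast
qed

lemma openin_weak_top_fs:
  assumes "\<psi> \<in> dual_fs V N" and "open U"
  shows "openin (weak_top_fs V N) {g \<in> V. \<psi> g \<in> U}"
  unfolding weak_top_fs_def
  by (rule topology_generated_by_Basis) (use assms in blast)

lemma continuous_map_weak_top_dual:
  assumes "\<psi> \<in> dual_fs V N"
  shows "continuous_map (weak_top_fs V N) euclidean \<psi>"
  using openin_weak_top_fs[OF assms] by (auto simp: continuous_map_def)

lemma continuous_map_into_weak_top:
  assumes "f ` topspace \<tau> \<subseteq> V"
    and "\<And>\<psi>. \<psi> \<in> dual_fs V N \<Longrightarrow> continuous_map \<tau> euclidean (\<lambda>x. \<psi> (f x))"
  shows "continuous_map \<tau> (weak_top_fs V N) f"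
  unfolding weak_top_fs_def
proof (rule continuous_on_generated_topo)
  fix W assume "W \<in> {{g \<in> V. \<psi> g \<in> U} |\<psi> U. \<psi> \<in> dual_fs V N \<and> open U}"
  then obtain \<psi> U where W: "W = {g \<in> V. \<psi> g \<in> U}" and \<psi>: "\<psi> \<in> dual_fs V N" and U: "open U"
    by blast
  have "f -` W \<inter> topspace \<tau> = {x \<in> topspace \<tau>. \<psi> (f x) \<in> U}"
    using assms(1) W by auto
  then show "openin \<tau> (f -` W \<inter> topspace \<tau>)"
    using assms(2)[OF \<psi>] U by (simp add: continuous_map_def)
next
  show "f ` topspace \<tau> \<subseteq> \<Union> {{g \<in> V. \<psi> g \<in> U} |\<psi> U. \<psi> \<in> dual_fs V N \<and> open U}"
    using assms(1) topspace_weak_top_fs[of V N] unfolding weak_top_fs_def topology_generated_by_topspace by simp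
qed

lemma Hausdorff_weak_top_fs:
  assumes "\<And>f g. \<lbrakk>f \<in> V; g \<in> V; f \<noteq> g\<rbrakk> \<Longrightarrow> \<exists>\<psi>\<in>dual_fs V N. \<psi> f \<noteq> \<psi> g"
  shows "Hausdorff_space (weak_top_fs V N)"
  unfolding Hausdorff_space_def
proof (intro allI impI)
  fix f g assume fg: "f \<in> topspace (weak_top_fs V N) \<and> g \<in> topspace (weak_top_fs V N) \<and> f \<noteq> g"
  then obtain \<psi> where \<psi>: "\<psi> \<in> dual_fs V N" "\<psi> f \<noteq> \<psi> g"
    using assms[of f g] by auto
  obtain U U' where "open U" "open U'" "\<psi> f \<in> U" "\<psi> g \<in> U'" "U \<inter> U' = {}"
    using hausdorff[OF \<psi>(2)] by blast
  then show "\<exists>U U'. openin (weak_top_fs V N) U \<and> openin (weak_top_fs V N) U' \<and> f \<in> U \<and> g \<in> U' \<and> disjnt U U'"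
    using fg \<psi>(1) openin_weak_top_fs[of \<psi> V N]
    by (intro exI[of _ "{g \<in> V. \<psi> g \<in> U}"] exI[of _ "{g \<in> V. \<psi> g \<in> U'}"]) (auto simp: disjnt_def)
qed

context normed_fs
begin

definition norm_dist :: "('a \<Rightarrow> complex) \<Rightarrow> ('a \<Rightarrow> complex) \<Rightarrow> real" where
  "norm_dist f g = (if f \<in> V \<and> g \<in> V then N (f - g) else 0)"

sublocale M: Metric_space V norm_dist
proof
  fix f g
  show "0 \<le> norm_dist f g"
    by (simp add: norm_dist_def norm_nonneg diff_mem)
  show "norm_dist f g = norm_dist g f"
    using norm_minus_commute by (simp add: norm_dist_def)
  show "norm_dist f g = 0 \<longleftrightarrow> f = g" if "f \<in> V" "g \<in> V"
    using that norm_eq_0[OF diff_mem[OF that]] norm_zero by (auto simp: norm_dist_def)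
  show "norm_dist f h \<le> norm_dist f g + norm_dist g h" if "f \<in> V" "g \<in> V" "h \<in> V" for h
    using norm_diff_triangle that by (simp add: norm_dist_def)
qed

lemma norm_top_fs_eq: "norm_top_fs V N = M.mtopology"
proof -
  let ?\<B> = "{{g \<in> V. N (g - f) < r} | f r. f \<in> V}"
  have ball: "{g \<in> V. N (g - f) < r} = M.mball f r" if "f \<in> V" for f r
    using that norm_minus_commute by (auto simp: norm_dist_def)
  have "openin (norm_top_fs V N) U" if U: "openin M.mtopology U" for U
  proof (subst openin_subopen, intro ballI)
    fix x assume "x \<in> U"
    then obtain r where "r > 0" and r: "M.mball x r \<subseteq> U" and "x \<in> V"
      using U unfolding M.openin_mtopology by blast
    have "openin (norm_top_fs V N) {g \<in> V. N (g - x) < r}"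
      unfolding norm_top_fs_def by (rule topology_generated_by_Basis) (use \<open>x \<in> V\<close> in blast)
    then show "\<exists>T. openin (norm_top_fs V N) T \<and> x \<in> T \<and> T \<subseteq> U"
      using r \<open>r > 0\<close> \<open>x \<in> V\<close> ball[OF \<open>x \<in> V\<close>] by (metis M.centre_in_mball_iff)
  qed
  moreover have "openin M.mtopology U" if "openin (norm_top_fs V N) U" for U
  proof -
    have "generate_topology_on ?\<B> U"
      using that by (simp add: norm_top_fs_def openin_topology_generated_by_iff)
    then show ?thesis
    proof induction
      case (Basis s)
      then show ?case
        using ball by (auto simp: M.openin_mball)
    qed auto
  qed
  ultimately show ?thesis
    by (metis topology_eq)
qed

lemma topspace_norm_top_fs: "topspace (norm_top_fs V N) = V"
  by (simp add: norm_top_fs_eq)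

lemma Hausdorff_norm_top_fs: "Hausdorff_space (norm_top_fs V N)"
  by (simp add: norm_top_fs_eq M.Hausdorff_space_mtopology)

lemma mcomplete_norm_dist:
  assumes "is_banach_fs V N"
  shows "M.mcomplete"
  unfolding M.mcomplete_def
proof (intro allI impI)
  fix \<sigma> :: "nat \<Rightarrow> 'a \<Rightarrow> complex" assume \<sigma>: "M.MCauchy \<sigma>"
  then have V: "\<sigma> n \<in> V" for n
    by (auto simp: M.MCauchy_def)
  have "\<exists>M. \<forall>m\<ge>M. \<forall>n\<ge>M. N (\<sigma> m - \<sigma> n) < e" if "e > 0" for e
    using \<sigma> that V unfolding M.MCauchy_def norm_dist_def by auto
  then obtain f where "f \<in> V" "\<forall>e>0. \<exists>M. \<forall>n\<ge>M. N (\<sigma> n - f) < e"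
    using assms V unfolding is_banach_fs_def by metis
  then have "limitin M.mtopology \<sigma> f sequentially"
    using V by (auto simp: M.limit_metric_sequentially norm_dist_def)
  then show "\<exists>x. limitin M.mtopology \<sigma> x sequentially"
    by blast
qed

lemma rel_compact_norm_top_iff:
  assumes "is_banach_fs V N" and "S \<subseteq> V"
  shows "rel_compact_in (norm_top_fs V N) S \<longleftrightarrow>
    (\<forall>e>0. \<exists>F. finite F \<and> F \<subseteq> S \<and> (\<forall>f\<in>S. \<exists>g\<in>F. N (f - g) < e))"
proof -
  have "rel_compact_in (norm_top_fs V N) S \<longleftrightarrow> M.mtotally_bounded S"
    using assms by (simp add: rel_compact_in_def norm_top_fs_eq M.mtotally_bounded_eq_compact_closure_of mcomplete_norm_dist)
  moreover have "S \<subseteq> (\<Union>x\<in>F. M.mball x e) \<longleftrightarrow> (\<forall>f\<in>S. \<exists>g\<in>F. N (f - g) < e)" if "F \<subseteq> S" for F e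
  proof -
    have "f \<in> M.mball g e \<longleftrightarrow> N (f - g) < e" if "f \<in> S" "g \<in> F" for f g
      using that \<open>F \<subseteq> S\<close> assms(2) norm_minus_commute[of f g] by (auto simp: norm_dist_def subset_iff)
    then show ?thesis by blast
  qed
  ultimately show ?thesis
    unfolding M.mtotally_bounded_def by (metis (no_types, lifting))
qed

end

subsection \<open>Norming families\<close>

text \<open>By the last assumption balls are closed for the topology of pointwise convergence on \<open>I\<close>; this encodes both
  completeness and the existence of weak limits.\<close>
locale norming_family = normed_fs V N
  for V :: "('a \<Rightarrow> complex) set" and N +
  fixes I :: "'i set" and s :: "'i \<Rightarrow> ('a \<Rightarrow> complex) \<Rightarrow> complex" and C :: real
  assumes index_nonempty: "I \<noteq> {}"
    and s_in_dual_ball: "i \<in> I \<Longrightarrow> s i \<in> dual_ball_fs V N 1"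
    and norm_le: "\<lbrakk>f \<in> V; \<And>i. i \<in> I \<Longrightarrow> cmod (s i f) \<le> a\<rbrakk> \<Longrightarrow> N f \<le> C * a"
    and const_pos: "C > 0"
    and finitely_approximable_attained:
      "(\<And>F e. \<lbrakk>finite F; F \<subseteq> I; e > 0\<rbrakk> \<Longrightarrow> \<exists>f\<in>V. N f \<le> B \<and> (\<forall>i\<in>F. dist (s i f) (u i) < e))
        \<Longrightarrow> \<exists>f\<in>V. \<forall>i\<in>I. s i f = u i"
begin

lemma s_in_dual: "i \<in> I \<Longrightarrow> s i \<in> dual_fs V N"
  using s_in_dual_ball dual_ball_fs_subset by blast

lemma s_le_norm: "\<lbrakk>i \<in> I; f \<in> V\<rbrakk> \<Longrightarrow> cmod (s i f) \<le> N f"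
  using dual_ball_fs_le[OF s_in_dual_ball] by fastforce

lemma s_diff: "\<lbrakk>i \<in> I; f \<in> V; g \<in> V\<rbrakk> \<Longrightarrow> s i (f - g) = s i f - s i g"
  using dual_fs_diff s_in_dual by blast

lemma s_separates:
  assumes "f \<in> V" "g \<in> V" "\<And>i. i \<in> I \<Longrightarrow> s i f = s i g"
  shows "f = g"
proof -
  have "N (f - g) \<le> C * 0"
    using assms by (intro norm_le diff_mem) (auto simp: s_diff)
  then show ?thesis
    using norm_eq_0[of "f - g"] norm_nonneg[of "f - g"] diff_mem[of f g] assms by simp
qed

lemma Hausdorff_weak_top: "Hausdorff_space (weak_top_fs V N)"
  using s_separates s_in_dual by (intro Hausdorff_weak_top_fs) blast

lemma bounded_pointwise_limit_attained:
  assumes "\<And>n. g n \<in> V" and bound: "\<forall>\<^sub>F n in sequentially. N (g n) \<le> B"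
    and lim: "\<And>i. i \<in> I \<Longrightarrow> (\<lambda>n. s i (g n)) \<longlonglongrightarrow> u i"
  shows "\<exists>f\<in>V. \<forall>i\<in>I. s i f = u i"
proof (rule finitely_approximable_attained)
  fix F :: "'i set" and e :: real assume F: "finite F" "F \<subseteq> I" and "e > 0"
  then have "\<forall>\<^sub>F n in sequentially. \<forall>i\<in>F. dist (s i (g n)) (u i) < e"
    using lim by (intro eventually_ball_finite ballI tendstoD) auto
  with bound have "\<forall>\<^sub>F n in sequentially. N (g n) \<le> B \<and> (\<forall>i\<in>F. dist (s i (g n)) (u i) < e)"
    by eventually_elim simp
  then show "\<exists>f\<in>V. N f \<le> B \<and> (\<forall>i\<in>F. dist (s i f) (u i) < e)"
    using assms(1) eventually_happens'[OF sequentially_bot] by blast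
qed

lemma Cauchy_tendsto_if_pointwise_tendsto:
  assumes g: "\<And>n. g n \<in> V" and cauchy: "\<And>e. e > 0 \<Longrightarrow> \<exists>M::nat. \<forall>m\<ge>M. \<forall>n\<ge>M. N (g m - g n) < e"
    and f: "f \<in> V" and lim: "\<And>i. i \<in> I \<Longrightarrow> (\<lambda>n. s i (g n)) \<longlonglongrightarrow> s i f" and "e > 0"
  shows "\<exists>M. \<forall>n\<ge>M. N (g n - f) < e"
proof -
  let ?e = "e / (2 * C)"
  have "?e > 0"
    using \<open>e > 0\<close> const_pos by simp
  then obtain M where M: "N (g n - g m) < ?e" if "m \<ge> M" "n \<ge> M" for m n
    using cauchy by metis
  have "N (g n - f) < e" if "n \<ge> M" for n
  proof -
    have "cmod (s i (g n - f)) \<le> ?e" if i: "i \<in> I" for i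
    proof (rule LIMSEQ_le_const2)
      show "(\<lambda>m. cmod (s i (g n) - s i (g m))) \<longlonglongrightarrow> cmod (s i (g n - f))"
        unfolding s_diff[OF i g f] by (intro tendsto_intros lim i)
      show "\<exists>M. \<forall>m\<ge>M. cmod (s i (g n) - s i (g m)) \<le> ?e"
        using s_le_norm[OF i diff_mem[OF g g]] M \<open>n \<ge> M\<close>
        by (intro exI[of _ M]) (metis less_imp_le order_trans s_diff[OF i g g])
    qed
    then have "N (g n - f) \<le> C * ?e"
      by (intro norm_le diff_mem g f) auto
    also have "\<dots> < e"
      using \<open>e > 0\<close> const_pos by simp
    finally show ?thesis .
  qed
  then show ?thesis by blast
qed

lemma complete:
  assumes g: "\<And>n. g n \<in> V" and cauchy: "\<And>e. e > 0 \<Longrightarrow> \<exists>M::nat. \<forall>m\<ge>M. \<forall>n\<ge>M. N (g m - g n) < e"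
  shows "\<exists>f\<in>V. \<forall>e>0. \<exists>M. \<forall>n\<ge>M. N (g n - f) < e"
proof -
  obtain M where M: "N (g n - g M) < 1" if "n \<ge> M" for n
    using cauchy[of 1] by auto
  have bound: "\<forall>\<^sub>F n in sequentially. N (g n) \<le> 1 + N (g M)"
    using eventually_ge_at_top[of M]
  proof eventually_elim
    case (elim n)
    then show ?case
      using norm_triangle[OF diff_mem[OF g g] g, of n M M] M[of n] by simp
  qed
  have "Cauchy (\<lambda>n. s i (g n))" if "i \<in> I" for i
    using cauchy s_le_norm[OF that diff_mem[OF g g]] s_diff[OF that g g]
    unfolding Cauchy_def dist_norm by (metis order_le_less_trans)
  then have "\<exists>l. i \<in> I \<longrightarrow> (\<lambda>n. s i (g n)) \<longlonglongrightarrow> l" for i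
    by (auto simp: Cauchy_convergent_iff convergent_def)
  then obtain u where u: "\<And>i. i \<in> I \<Longrightarrow> (\<lambda>n. s i (g n)) \<longlonglongrightarrow> u i"
    by metis
  obtain f where f: "f \<in> V" "\<And>i. i \<in> I \<Longrightarrow> s i f = u i"
    using bounded_pointwise_limit_attained[OF g bound u] by blast
  then have "(\<lambda>n. s i (g n)) \<longlonglongrightarrow> s i f" if "i \<in> I" for i
    using u that by simp
  with f(1) show ?thesis
    using Cauchy_tendsto_if_pointwise_tendsto[OF g cauchy] by blast
qed

lemma is_banach: "is_banach_fs V N"
  unfolding is_banach_fs_def
proof (intro conjI ballI allI impI)
  show "N f = 0 \<longleftrightarrow> f = 0" if "f \<in> V" for f
    using norm_eq_0[OF that] norm_zero by blast
  show "\<exists>f\<in>V. \<forall>e>0. \<exists>M::nat. \<forall>n\<ge>M. N (fs n - f) < e"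
    if "(\<forall>n. fs n \<in> V) \<and> (\<forall>e>0. \<exists>M::nat. \<forall>m\<ge>M. \<forall>n\<ge>M. N (fs m - fs n) < e)" for fs
    using that by (intro complete) simp_all
qed (simp_all add: zero_mem add_mem csmul_mem norm_nonneg norm_triangle norm_csmul)

definition weak_star_closure :: "(('a \<Rightarrow> complex) \<Rightarrow> complex) set" where
  "weak_star_closure = closure (s ` I)"

lemma s_in_closure: "i \<in> I \<Longrightarrow> s i \<in> weak_star_closure"
  unfolding weak_star_closure_def by (rule subsetD[OF closure_subset]) simp

lemma closure_subset_dual_ball: "weak_star_closure \<subseteq> dual_ball_fs V N 1"
  unfolding weak_star_closure_def using s_in_dual_ball by (intro closure_minimal closed_dual_ball_fs) auto

lemma closure_in_dual: "\<gamma> \<in> weak_star_closure \<Longrightarrow> \<gamma> \<in> dual_fs V N"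
  using closure_subset_dual_ball dual_ball_fs_subset by blast

lemma closure_le_norm: "\<lbrakk>\<gamma> \<in> weak_star_closure; f \<in> V\<rbrakk> \<Longrightarrow> cmod (\<gamma> f) \<le> N f"
  using dual_ball_fs_le[OF subsetD[OF closure_subset_dual_ball]] by fastforce

lemma compact_weak_star_closure: "compact weak_star_closure"
  using compact_Int_closed[OF compact_dual_ball_fs closed_closure, of V N 1 "s ` I"] closure_subset_dual_ball
  by (simp add: weak_star_closure_def Int_absorb1)

lemma finite_net:
  assumes "finite F" and "e > 0"
  obtains J where "finite J" "J \<subseteq> I" "\<And>i. i \<in> I \<Longrightarrow> \<exists>j\<in>J. \<forall>f\<in>F. dist (s i f) (s j f) < e"
proof -
  let ?U = "\<lambda>j. {\<phi>. \<forall>f\<in>F. dist (\<phi> f) (s j f) < e}"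
  have "open (?U j)" if "j \<in> I" for j
    using assms(1) by (simp only: Collect_ball_eq) (intro open_INT ballI open_Collect_less continuous_intros)
  moreover have "weak_star_closure \<subseteq> (\<Union>j\<in>I. ?U j)"
  proof
    fix \<phi> assume "\<phi> \<in> weak_star_closure"
    then obtain \<psi> where "\<psi> \<in> s ` I" "\<And>f. f \<in> F \<Longrightarrow> dist (\<psi> f) (\<phi> f) < e"
      using closure_fun_finite_approx[of \<phi> "s ` I" F e] assms unfolding weak_star_closure_def by blast
    then show "\<phi> \<in> (\<Union>j\<in>I. ?U j)"
      by (auto simp: dist_commute)
  qed
  ultimately obtain J where J: "J \<subseteq> I" "finite J" and cover: "weak_star_closure \<subseteq> (\<Union>j\<in>J. ?U j)"
    by (rule compactE_image[OF compact_weak_star_closure])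
  have "\<exists>j\<in>J. \<forall>f\<in>F. dist (s i f) (s j f) < e" if "i \<in> I" for i
    using subsetD[OF cover s_in_closure[OF that]] by auto
  with J show ?thesis
    using that by blast
qed

lemma midpoint_hull_dominates:
  assumes \<psi>: "\<psi> \<in> dual_fs V N" and g: "\<And>n. g n \<in> V" and \<delta>: "\<And>n. \<delta> \<le> Re (\<psi> (g n))"
    and "h \<in> midpoint_hull (range (\<lambda>n \<gamma>. cmod (\<gamma> (g n))))"
  shows "\<exists>f\<in>V. \<delta> \<le> Re (\<psi> f) \<and> (\<forall>\<gamma>\<in>weak_star_closure. cmod (\<gamma> f) \<le> h \<gamma>)"
  using assms(4)
proof induction
  case (base h)
  then show ?case
    using g \<delta> by auto
next
  case (midpoint h\<^sub>1 h\<^sub>2)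
  then obtain f\<^sub>1 f\<^sub>2 where f: "f\<^sub>1 \<in> V" "\<delta> \<le> Re (\<psi> f\<^sub>1)" "f\<^sub>2 \<in> V" "\<delta> \<le> Re (\<psi> f\<^sub>2)"
    and h: "\<And>\<gamma>. \<gamma> \<in> weak_star_closure \<Longrightarrow> cmod (\<gamma> f\<^sub>1) \<le> h\<^sub>1 \<gamma>" "\<And>\<gamma>. \<gamma> \<in> weak_star_closure \<Longrightarrow> cmod (\<gamma> f\<^sub>2) \<le> h\<^sub>2 \<gamma>"
    by blast
  let ?f = "csmul (1/2) (f\<^sub>1 + f\<^sub>2)"
  have eval: "\<phi> ?f = (\<phi> f\<^sub>1 + \<phi> f\<^sub>2) / 2" if "\<phi> \<in> dual_fs V N" for \<phi>
    using that f by (simp add: dual_fs_csmul dual_fs_add add_mem)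
  have "cmod (\<gamma> ?f) \<le> (h\<^sub>1 \<gamma> + h\<^sub>2 \<gamma>) / 2" if "\<gamma> \<in> weak_star_closure" for \<gamma>
    unfolding eval[OF closure_in_dual[OF that]]
    using h[OF that] norm_triangle_ineq[of "\<gamma> f\<^sub>1" "\<gamma> f\<^sub>2"] by (simp add: norm_divide)
  moreover have "\<delta> \<le> Re (\<psi> ?f)"
    unfolding eval[OF \<psi>] using f by simp
  ultimately show ?case
    using f csmul_mem add_mem by blast
qed

lemma not_null_on_closure_if_Re_bounded_below:
  assumes \<psi>: "\<psi> \<in> dual_fs V N" and g: "\<And>n. g n \<in> V" and bound: "\<And>n. N (g n) \<le> B"
    and "\<delta> > 0" and \<delta>: "\<And>n. \<delta> \<le> Re (\<psi> (g n))"
  shows "\<exists>\<gamma>\<in>weak_star_closure. \<not> (\<lambda>n. \<gamma> (g n)) \<longlonglongrightarrow> 0"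
proof (rule ccontr)
  assume null: "\<not> ?thesis"
  obtain r where "r > 0" and r: "\<psi> \<in> dual_ball_fs V N r"
    using dual_fs_in_dual_ball[OF \<psi>] .
  define e where "e = \<delta> / (2 * r * C)"
  have "e > 0"
    using \<open>\<delta> > 0\<close> \<open>r > 0\<close> const_pos by (simp add: e_def)
  have "\<exists>h\<in>midpoint_hull (range (\<lambda>n \<gamma>. cmod (\<gamma> (g n)))). \<forall>\<gamma>\<in>weak_star_closure. h \<gamma> < e"
  proof (rule pointwise_null_imp_midpoint_mean_small[OF compact_weak_star_closure _ _ _ \<open>e > 0\<close>])
    show "continuous_on weak_star_closure (\<lambda>\<gamma>. cmod (\<gamma> (g n)))" for n
      by (intro continuous_intros)
    show "cmod (\<gamma> (g n)) \<in> {0..B}" if "\<gamma> \<in> weak_star_closure" for \<gamma> n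
      using order_trans[OF closure_le_norm[OF that g] bound] by simp
    show "(\<lambda>n. cmod (\<gamma> (g n))) \<longlonglongrightarrow> 0" if "\<gamma> \<in> weak_star_closure" for \<gamma>
      using null that tendsto_norm_zero by blast
  qed
  then obtain h where "h \<in> midpoint_hull (range (\<lambda>n \<gamma>. cmod (\<gamma> (g n))))"
    and h: "\<And>\<gamma>. \<gamma> \<in> weak_star_closure \<Longrightarrow> h \<gamma> < e"
    by blast
  then obtain f where f: "f \<in> V" "\<delta> \<le> Re (\<psi> f)" and "\<And>\<gamma>. \<gamma> \<in> weak_star_closure \<Longrightarrow> cmod (\<gamma> f) \<le> h \<gamma>"
    using midpoint_hull_dominates[where g = g, OF \<psi> g \<delta>] by blast
  then have small: "cmod (\<gamma> f) \<le> e" if "\<gamma> \<in> weak_star_closure" for \<gamma>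
    using h[OF that] that by fastforce
  have "\<delta> \<le> r * N f"
    using f(2) complex_Re_le_cmod[of "\<psi> f"] dual_ball_fs_le[OF r f(1)] by linarith
  also have "\<dots> \<le> r * (C * e)"
    using norm_le[OF f(1) small[OF s_in_closure]] \<open>r > 0\<close> by simp
  also have "\<dots> < \<delta>"
    using \<open>\<delta> > 0\<close> \<open>r > 0\<close> const_pos by (simp add: e_def)
  finally show False
    by simp
qed

theorem weakly_null_if_null_on_closure:
  assumes \<psi>: "\<psi> \<in> dual_fs V N" and g: "\<And>n. g n \<in> V" and bound: "\<And>n. N (g n) \<le> B"
    and null: "\<And>\<gamma>. \<gamma> \<in> weak_star_closure \<Longrightarrow> (\<lambda>n. \<gamma> (g n)) \<longlonglongrightarrow> 0"
  shows "(\<lambda>n. \<psi> (g n)) \<longlonglongrightarrow> 0"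
proof (rule ccontr)
  assume "\<not> (\<lambda>n. \<psi> (g n)) \<longlonglongrightarrow> 0"
  from not_null_imp_large_subseq[OF this] obtain \<delta> and r :: "nat \<Rightarrow> nat"
    where "\<delta> > 0" and r: "strict_mono r" "\<And>n. \<delta> \<le> cmod (\<psi> (g (r n)))"
    by blast
  define c where "c n = cnj (sgn (\<psi> (g (r n))))" for n
  define g' where "g' n = csmul (c n) (g (r n))" for n
  have c_le: "cmod (c n) \<le> 1" for n
    by (simp add: c_def norm_sgn)
  have "\<delta> \<le> Re (\<psi> (g' n))" for n
  proof -
    have "cnj (sgn a) * a = of_real (cmod a)" for a
      using complex_norm_square[of a]
      by (cases "a = 0") (simp_all add: sgn_eq power2_eq_square field_simps)
    then have "\<psi> (g' n) = of_real (cmod (\<psi> (g (r n))))"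
      by (simp add: g'_def dual_fs_csmul[OF \<psi> g] c_def)
    then show ?thesis
      using r(2) by simp
  qed
  moreover have "N (g' n) \<le> B" for n
    using mult_mono[OF c_le[of n] bound[of "r n"]] norm_nonneg[OF g] by (simp add: g'_def norm_csmul g)
  moreover have "g' n \<in> V" for n
    by (simp add: g'_def csmul_mem g)
  ultimately obtain \<gamma> where \<gamma>: "\<gamma> \<in> weak_star_closure" "\<not> (\<lambda>n. \<gamma> (g' n)) \<longlonglongrightarrow> 0"
    using not_null_on_closure_if_Re_bounded_below[OF \<psi> _ _ \<open>\<delta> > 0\<close>] by metis
  have lim: "(\<lambda>n. \<gamma> (g (r n))) \<longlonglongrightarrow> 0"
    using LIMSEQ_subseq_LIMSEQ[OF null[OF \<gamma>(1)] r(1)] by (simp add: o_def)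
  have "(\<lambda>n. \<gamma> (g' n)) \<longlonglongrightarrow> 0"
  proof (rule Lim_null_comparison[OF _ tendsto_norm_zero[OF lim]])
    show "\<forall>\<^sub>F n in sequentially. cmod (\<gamma> (g' n)) \<le> cmod (\<gamma> (g (r n)))"
      using c_le by (simp add: g'_def dual_fs_csmul[OF closure_in_dual[OF \<gamma>(1)] g] norm_mult mult_left_le_one_le)
  qed
  with \<gamma>(2) show False ..
qed

lemma weak_closure_if_finite_approx:
  assumes W: "compactin (weak_top_fs V N) W" and "D \<subseteq> W" and w: "w \<in> V" and "J \<subseteq> I"
    and sep: "\<And>f. \<lbrakk>f \<in> V; \<And>j. j \<in> J \<Longrightarrow> s j f = s j w\<rbrakk> \<Longrightarrow> f = w"
    and approx: "\<And>F e. \<lbrakk>finite F; F \<subseteq> J; e > 0\<rbrakk> \<Longrightarrow> \<exists>d\<in>D. \<forall>j\<in>F. dist (s j d) (s j w) < e"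
  shows "w \<in> weak_top_fs V N closure_of D"
proof -
  let ?C = "weak_top_fs V N closure_of D"
  have "D \<subseteq> V"
    using \<open>D \<subseteq> W\<close> compactin_subset_topspace[OF W] by simp
  then have "D \<subseteq> ?C"
    by (simp add: closure_of_subset)
  have "?C \<subseteq> W"
    using compactin_imp_closedin[OF Hausdorff_weak_top W] \<open>D \<subseteq> W\<close> by (simp add: closure_of_minimal)
  then have "compactin (weak_top_fs V N) ?C"
    using closed_compactin[OF W] closedin_closure_of by blast
  then have "\<exists>f\<in>?C. \<forall>j\<in>J. s j f = s j w"
  proof (rule compactin_finite_approx_attained)
    show "continuous_map (weak_top_fs V N) euclidean (s j)" if "j \<in> J" for j
      using that \<open>J \<subseteq> I\<close> by (intro continuous_map_weak_top_dual s_in_dual) auto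
    show "\<exists>d\<in>?C. \<forall>j\<in>F. dist (s j d) (s j w) < e" if "finite F" "F \<subseteq> J" "e > 0" for F e
      using approx[OF that] \<open>D \<subseteq> ?C\<close> by blast
  qed
  then obtain f where f: "f \<in> ?C" "\<And>j. j \<in> J \<Longrightarrow> s j f = s j w"
    by blast
  then have "f \<in> V"
    using closure_of_subset_topspace[of "weak_top_fs V N"] by auto
  with f sep show ?thesis
    by blast
qed

definition separable_index :: bool where
  "separable_index \<longleftrightarrow> (\<exists>j :: nat \<Rightarrow> 'i. range j \<subseteq> I \<and> s ` I \<subseteq> closure (s ` range j))"

lemma eq_if_eq_on_dense_index:
  assumes "s ` I \<subseteq> closure (s ` J)" and "f \<in> V" "g \<in> V" and "\<And>j. j \<in> J \<Longrightarrow> s j f = s j g"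
  shows "f = g"
proof (rule s_separates[OF assms(2,3)])
  have "closed {\<phi> :: ('a \<Rightarrow> complex) \<Rightarrow> complex. \<phi> f = \<phi> g}"
    by (intro closed_Collect_eq continuous_intros)
  then have "closure (s ` J) \<subseteq> {\<phi>. \<phi> f = \<phi> g}"
    using assms(4) by (intro closure_minimal) auto
  then show "s i f = s i g" if "i \<in> I" for i
    using assms(1) that by blast
qed

lemma weakly_compact_separable:
  assumes W: "compactin (weak_top_fs V N) W" "W \<noteq> {}" and separable_index
  obtains d :: "nat \<Rightarrow> 'a \<Rightarrow> complex" where "W \<subseteq> weak_top_fs V N closure_of (range d)"
proof -
  obtain j :: "nat \<Rightarrow> 'i" where j: "range j \<subseteq> I" "s ` I \<subseteq> closure (s ` range j)"
    using assms(3) unfolding separable_index_def by (elim exE conjE)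
  let ?R = "\<lambda>f (n::nat). s (j n) f"
  have W_V: "W \<subseteq> V"
    using compactin_subset_topspace[OF W(1)] by simp
  obtain D' where "countable D'" "D' \<subseteq> ?R ` W" and dense: "?R ` W \<subseteq> closure D'"
    using separable by blast
  then obtain D where D: "countable D" "D \<subseteq> W" "D' = ?R ` D"
    using countable_subset_image[of D' ?R W] by auto
  have "W \<subseteq> weak_top_fs V N closure_of D"
  proof
    fix w assume w: "w \<in> W"
    show "w \<in> weak_top_fs V N closure_of D"
    proof (rule weak_closure_if_finite_approx[OF W(1) D(2) _ j(1)])
      show "w \<in> V"
        using w W_V by blast
      then show "f = w" if "f \<in> V" "\<And>i. i \<in> range j \<Longrightarrow> s i f = s i w" for f
        using eq_if_eq_on_dense_index[OF j(2)] that by blast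
      fix F and e :: real assume F: "finite F" "F \<subseteq> range j" "e > 0"
      then obtain M where M: "finite M" "F = j ` M"
        by (meson finite_subset_image)
      obtain h where "h \<in> ?R ` D" "\<And>n. n \<in> M \<Longrightarrow> dist (h n) (?R w n) < e"
        using closure_fun_finite_approx[of "?R w" D' M e] w dense D(3) M(1) F(3) by blast
      then show "\<exists>d\<in>D. \<forall>i\<in>F. dist (s i d) (s i w) < e"
        using M(2) by auto
    qed
  qed
  moreover from this have "D \<noteq> {}"
    using W(2) by auto
  ultimately show ?thesis
    using that[of "from_nat_into D"] D by (simp add: range_from_nat_into)
qed

lemma tendsto_on_weak_closure:
  assumes W: "W \<subseteq> V" "W \<subseteq> weak_top_fs V N closure_of (range d)"
    and \<phi>: "\<And>n. \<phi> n \<in> weak_star_closure" "\<psi> \<in> weak_star_closure"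
    and lim: "\<And>k::nat. (\<lambda>n. \<phi> n (d k)) \<longlonglongrightarrow> \<psi> (d k)" and y: "y \<in> W"
  shows "(\<lambda>n. \<phi> n y) \<longlonglongrightarrow> \<psi> y"
proof (rule compact_image_factor_tendsto[where Q = weak_star_closure and h = "\<lambda>\<phi>. \<phi> y" and x = \<phi>])
  show "((\<lambda>n k. \<phi> n (d k)) \<longlongrightarrow> (\<lambda>k. \<psi> (d k))) sequentially"
    using lim by (simp add: tendsto_fun_iff)
  fix \<psi>' assume \<psi>': "\<psi>' \<in> weak_star_closure" "(\<lambda>k. \<psi>' (d k)) = (\<lambda>k. \<psi> (d k))"
  show "\<psi>' y = \<psi> y"
  proof (rule forall_in_closure_of_eq[OF subsetD[OF W(2) y] Hausdorff_space_euclidean])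
    show "continuous_map (weak_top_fs V N) euclidean \<psi>'" "continuous_map (weak_top_fs V N) euclidean \<psi>"
      using \<psi>'(1) \<phi>(2) by (auto intro: continuous_map_weak_top_dual closure_in_dual)
    show "\<psi>' f = \<psi> f" if "f \<in> range d" for f
      using that \<psi>'(2) by (metis rangeE)
  qed
qed (use \<phi> in \<open>auto intro!: continuous_intros compact_weak_star_closure\<close>)

end

subsection \<open>Interchanging the variables of a bounded kernel\<close>

locale bounded_kernel =
  E1: norming_family V\<^sub>1 N\<^sub>1 I s\<^sub>1 C\<^sub>1 + E2: norming_family V\<^sub>2 N\<^sub>2 K s\<^sub>2 C\<^sub>2
  for V\<^sub>1 :: "('a \<Rightarrow> complex) set" and N\<^sub>1 and I :: "'i set" and s\<^sub>1 and C\<^sub>1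
    and V\<^sub>2 :: "('b \<Rightarrow> complex) set" and N\<^sub>2 and K :: "'k set" and s\<^sub>2 and C\<^sub>2 +
  fixes column :: "'k \<Rightarrow> 'a \<Rightarrow> complex" and row :: "'i \<Rightarrow> 'b \<Rightarrow> complex" and B :: real
  assumes column_mem: "k \<in> K \<Longrightarrow> column k \<in> V\<^sub>1" and row_mem: "i \<in> I \<Longrightarrow> row i \<in> V\<^sub>2"
    and column_bound: "k \<in> K \<Longrightarrow> N\<^sub>1 (column k) \<le> B" and row_bound: "i \<in> I \<Longrightarrow> N\<^sub>2 (row i) \<le> B"
    and pairing: "\<lbrakk>i \<in> I; k \<in> K\<rbrakk> \<Longrightarrow> s\<^sub>1 i (column k) = s\<^sub>2 k (row i)"
begin

lemma bounded_kernel_swap: "bounded_kernel V\<^sub>2 N\<^sub>2 K s\<^sub>2 C\<^sub>2 V\<^sub>1 N\<^sub>1 I s\<^sub>1 C\<^sub>1 row column B"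
  by unfold_locales (use column_mem row_mem column_bound row_bound pairing in auto)

lemma s_row_diff_le:
  assumes "i \<in> I" "j \<in> I" "k \<in> K" "l \<in> K"
    and "N\<^sub>1 (column k - column l) \<le> e" and "dist (s\<^sub>1 i (column l)) (s\<^sub>1 j (column l)) \<le> e"
  shows "cmod (s\<^sub>2 k (row i - row j)) \<le> 3 * e"
proof -
  have column_close: "dist (s\<^sub>1 i' (column k)) (s\<^sub>1 i' (column l)) \<le> e" if "i' \<in> I" for i'
    using E1.s_le_norm[OF that E1.diff_mem[OF column_mem column_mem], of k l] assms(3-5) that
    by (simp add: dist_norm E1.s_diff column_mem)
  have "cmod (s\<^sub>2 k (row i - row j)) = dist (s\<^sub>1 i (column k)) (s\<^sub>1 j (column k))"
    using assms(1-3) by (simp add: E2.s_diff row_mem pairing dist_norm)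
  also have "\<dots> \<le> dist (s\<^sub>1 i (column k)) (s\<^sub>1 i (column l)) + dist (s\<^sub>1 i (column l)) (s\<^sub>1 j (column l))
      + dist (s\<^sub>1 j (column k)) (s\<^sub>1 j (column l))"
    using dist_triangle[of "s\<^sub>1 i (column k)" "s\<^sub>1 j (column k)" "s\<^sub>1 i (column l)"]
      dist_triangle[of "s\<^sub>1 i (column l)" "s\<^sub>1 j (column k)" "s\<^sub>1 j (column l)"] by (simp add: dist_commute)
  also have "\<dots> \<le> 3 * e"
    using column_close[OF assms(1)] column_close[OF assms(2)] assms(6) by simp
  finally show ?thesis .
qed

lemma finite_row_net:
  assumes F: "finite F" "F \<subseteq> K" "\<And>k. k \<in> K \<Longrightarrow> \<exists>l\<in>F. N\<^sub>1 (column k - column l) < e" and "e > 0"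
  obtains J where "finite J" "J \<subseteq> I" "\<And>i. i \<in> I \<Longrightarrow> \<exists>j\<in>J. N\<^sub>2 (row i - row j) \<le> C\<^sub>2 * (3 * e)"
proof -
  obtain J where J: "finite J" "J \<subseteq> I"
    and net: "\<And>i. i \<in> I \<Longrightarrow> \<exists>j\<in>J. \<forall>f\<in>column ` F. dist (s\<^sub>1 i f) (s\<^sub>1 j f) < e"
    using E1.finite_net[OF finite_imageI[OF F(1)] \<open>e > 0\<close>] by blast
  have "\<exists>j\<in>J. N\<^sub>2 (row i - row j) \<le> C\<^sub>2 * (3 * e)" if i: "i \<in> I" for i
  proof -
    obtain j where "j \<in> J" and j: "\<And>l. l \<in> F \<Longrightarrow> dist (s\<^sub>1 i (column l)) (s\<^sub>1 j (column l)) < e"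
      using net[OF i] by blast
    then have "j \<in> I"
      using J by blast
    have "cmod (s\<^sub>2 k (row i - row j)) \<le> 3 * e" if k: "k \<in> K" for k
    proof -
      obtain l where "l \<in> F" "N\<^sub>1 (column k - column l) < e"
        using F(3)[OF k] by blast
      then show ?thesis
        using j F(2) by (intro s_row_diff_le[OF i \<open>j \<in> I\<close> k, of l]) (auto intro: less_imp_le)
    qed
    then have "N\<^sub>2 (row i - row j) \<le> C\<^sub>2 * (3 * e)"
      using i \<open>j \<in> I\<close> row_mem by (intro E2.norm_le E2.diff_mem) auto
    with \<open>j \<in> J\<close> show ?thesis ..
  qed
  with J show ?thesis
    using that by blast
qed

lemma rel_compact_rows:
  assumes "rel_compact_in (norm_top_fs V\<^sub>1 N\<^sub>1) (column ` K)"
  shows "rel_compact_in (norm_top_fs V\<^sub>2 N\<^sub>2) (row ` I)"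
proof -
  have "column ` K \<subseteq> V\<^sub>1" and rows: "row ` I \<subseteq> V\<^sub>2"
    using column_mem row_mem by auto
  then have columns: "\<exists>F. finite F \<and> F \<subseteq> column ` K \<and> (\<forall>f\<in>column ` K. \<exists>g\<in>F. N\<^sub>1 (f - g) < e)" if "e > 0" for e
    using assms that E1.rel_compact_norm_top_iff[OF E1.is_banach] by simp
  have "\<exists>F. finite F \<and> F \<subseteq> row ` I \<and> (\<forall>f\<in>row ` I. \<exists>g\<in>F. N\<^sub>2 (f - g) < e)" if "e > 0" for e
  proof -
    define r where "r = e / (4 * C\<^sub>2)"
    have "r > 0" and r: "C\<^sub>2 * (3 * r) < e"
      using \<open>e > 0\<close> E2.const_pos by (simp_all add: r_def)
    obtain F' where F': "finite F'" "F' \<subseteq> column ` K" "\<forall>f\<in>column ` K. \<exists>g\<in>F'. N\<^sub>1 (f - g) < r"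
      using columns[OF \<open>r > 0\<close>] by (elim exE conjE)
    then obtain F where F: "finite F" "F \<subseteq> K" "F' = column ` F"
      using finite_subset_image[of F' column K] by auto
    then have "\<exists>l\<in>F. N\<^sub>1 (column k - column l) < r" if "k \<in> K" for k
      using F'(3) that by auto
    then obtain J where J: "finite J" "J \<subseteq> I" "\<And>i. i \<in> I \<Longrightarrow> \<exists>j\<in>J. N\<^sub>2 (row i - row j) \<le> C\<^sub>2 * (3 * r)"
      using finite_row_net[OF F(1,2) _ \<open>r > 0\<close>] by blast
    have "\<exists>j\<in>J. N\<^sub>2 (row i - row j) < e" if "i \<in> I" for i
      using J(3)[OF that] r by (meson order_le_less_trans)
    then show ?thesis
      using J(1,2) by (intro exI[of _ "row ` J"]) auto
  qed
  then show ?thesis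
    using E2.rel_compact_norm_top_iff[OF E2.is_banach rows] by simp
qed

theorem rel_compact_columns_iff_rows:
  "rel_compact_in (norm_top_fs V\<^sub>1 N\<^sub>1) (column ` K) \<longleftrightarrow> rel_compact_in (norm_top_fs V\<^sub>2 N\<^sub>2) (row ` I)"
  using rel_compact_rows bounded_kernel.rel_compact_rows[OF bounded_kernel_swap] by blast

lemma ex_limit_row:
  assumes "\<psi> \<in> E1.weak_star_closure"
  shows "\<exists>f\<in>V\<^sub>2. \<forall>k\<in>K. s\<^sub>2 k f = \<psi> (column k)"
proof (rule E2.finitely_approximable_attained[where B = B])
  fix F and e :: real assume F: "finite F" "F \<subseteq> K" and "e > 0"
  then obtain \<phi> where "\<phi> \<in> s\<^sub>1 ` I" "\<And>f. f \<in> column ` F \<Longrightarrow> dist (\<phi> f) (\<psi> f) < e"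
    using closure_fun_finite_approx[of \<psi> "s\<^sub>1 ` I" "column ` F" e] assms unfolding E1.weak_star_closure_def by blast
  then obtain i where "i \<in> I" "\<And>k. k \<in> F \<Longrightarrow> dist (s\<^sub>1 i (column k)) (\<psi> (column k)) < e"
    by blast
  then show "\<exists>f\<in>V\<^sub>2. N\<^sub>2 f \<le> B \<and> (\<forall>k\<in>F. dist (s\<^sub>2 k f) (\<psi> (column k)) < e)"
    using F(2) row_mem row_bound by (intro bexI[of _ "row i"]) (auto simp flip: pairing)
qed

definition limit_row :: "(('a \<Rightarrow> complex) \<Rightarrow> complex) \<Rightarrow> 'b \<Rightarrow> complex" where
  "limit_row \<psi> = (SOME f. f \<in> V\<^sub>2 \<and> (\<forall>k\<in>K. s\<^sub>2 k f = \<psi> (column k)))"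

lemma
  assumes "\<psi> \<in> E1.weak_star_closure"
  shows limit_row_mem: "limit_row \<psi> \<in> V\<^sub>2"
    and s_limit_row: "k \<in> K \<Longrightarrow> s\<^sub>2 k (limit_row \<psi>) = \<psi> (column k)"
proof -
  have "\<exists>f. f \<in> V\<^sub>2 \<and> (\<forall>k\<in>K. s\<^sub>2 k f = \<psi> (column k))"
    using ex_limit_row[OF assms] by blast
  from someI_ex[OF this] show "limit_row \<psi> \<in> V\<^sub>2" "k \<in> K \<Longrightarrow> s\<^sub>2 k (limit_row \<psi>) = \<psi> (column k)"
    by (auto simp: limit_row_def)
qed

lemma limit_row_s: "i \<in> I \<Longrightarrow> limit_row (s\<^sub>1 i) = row i"
  using E1.s_in_closure by (intro E2.s_separates) (auto simp: limit_row_mem row_mem s_limit_row pairing)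

lemma limit_row_bound:
  assumes "\<psi> \<in> E1.weak_star_closure"
  shows "N\<^sub>2 (limit_row \<psi>) \<le> C\<^sub>2 * B"
proof (rule E2.norm_le[OF limit_row_mem[OF assms]])
  fix k assume "k \<in> K"
  then show "cmod (s\<^sub>2 k (limit_row \<psi>)) \<le> B"
    using order_trans[OF E1.closure_le_norm[OF assms column_mem] column_bound] by (simp add: s_limit_row[OF assms])
qed

lemma closure_acts_on_limit_rows:
  assumes W: "compactin (weak_top_fs V\<^sub>1 N\<^sub>1) W" "column ` K \<subseteq> W" and \<gamma>: "\<gamma> \<in> E2.weak_star_closure"
  shows "\<exists>y\<in>W. \<forall>\<psi>\<in>E1.weak_star_closure. \<psi> y = \<gamma> (limit_row \<psi>)"
proof (rule compactin_finite_approx_attained[OF W(1)])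
  show "continuous_map (weak_top_fs V\<^sub>1 N\<^sub>1) euclidean \<psi>" if "\<psi> \<in> E1.weak_star_closure" for \<psi>
    using that by (intro continuous_map_weak_top_dual E1.closure_in_dual)
  fix F :: "(('a \<Rightarrow> complex) \<Rightarrow> complex) set" and e :: real assume F: "finite F" "F \<subseteq> E1.weak_star_closure" and "e > 0"
  then obtain \<phi> where "\<phi> \<in> s\<^sub>2 ` K" "\<And>f. f \<in> limit_row ` F \<Longrightarrow> dist (\<phi> f) (\<gamma> f) < e"
    using closure_fun_finite_approx[of \<gamma> "s\<^sub>2 ` K" "limit_row ` F" e] \<gamma> unfolding E2.weak_star_closure_def by blast
  then obtain k where "k \<in> K" "\<And>\<psi>. \<psi> \<in> F \<Longrightarrow> dist (s\<^sub>2 k (limit_row \<psi>)) (\<gamma> (limit_row \<psi>)) < e"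
    by blast
  then show "\<exists>y\<in>W. \<forall>\<psi>\<in>F. dist (\<psi> y) (\<gamma> (limit_row \<psi>)) < e"
    using F(2) W(2) by (intro bexI[of _ "column k"]) (auto simp flip: s_limit_row)
qed

lemma limit_row_tendsto:
  assumes W: "compactin (weak_top_fs V\<^sub>1 N\<^sub>1) W" "column ` K \<subseteq> W"
    and \<phi>: "\<And>n. \<phi> n \<in> E1.weak_star_closure" and \<psi>: "\<psi> \<in> E1.weak_star_closure"
    and lim: "\<And>y. y \<in> W \<Longrightarrow> (\<lambda>n. \<phi> n y) \<longlonglongrightarrow> \<psi> y" and \<Psi>: "\<Psi> \<in> dual_fs V\<^sub>2 N\<^sub>2"
  shows "(\<lambda>n. \<Psi> (limit_row (\<phi> n))) \<longlonglongrightarrow> \<Psi> (limit_row \<psi>)"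
proof -
  have mem: "limit_row (\<phi> n) \<in> V\<^sub>2" "limit_row \<psi> \<in> V\<^sub>2" for n
    using \<phi> \<psi> by (auto intro: limit_row_mem)
  have "(\<lambda>n. \<Psi> (limit_row (\<phi> n) - limit_row \<psi>)) \<longlonglongrightarrow> 0"
  proof (rule E2.weakly_null_if_null_on_closure[OF \<Psi>])
    show "limit_row (\<phi> n) - limit_row \<psi> \<in> V\<^sub>2" for n
      by (intro E2.diff_mem mem)
    show "N\<^sub>2 (limit_row (\<phi> n) - limit_row \<psi>) \<le> C\<^sub>2 * B + C\<^sub>2 * B" for n
      using E2.norm_diff_triangle[OF mem(1) E2.zero_mem mem(2), of n] E2.norm_minus_commute[OF mem(2) E2.zero_mem]
        limit_row_bound[OF \<phi>, of n] limit_row_bound[OF \<psi>]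
      by (simp add: mult.commute)
    fix \<gamma> assume \<gamma>: "\<gamma> \<in> E2.weak_star_closure"
    obtain y where "y \<in> W" and y: "\<And>\<psi>. \<psi> \<in> E1.weak_star_closure \<Longrightarrow> \<psi> y = \<gamma> (limit_row \<psi>)"
      using closure_acts_on_limit_rows[OF W \<gamma>] by blast
    then show "(\<lambda>n. \<gamma> (limit_row (\<phi> n) - limit_row \<psi>)) \<longlonglongrightarrow> 0"
      using lim[OF \<open>y \<in> W\<close>] by (simp add: E2.dual_fs_diff[OF E2.closure_in_dual[OF \<gamma>] mem] \<phi> \<psi> LIM_zero)
  qed
  then show ?thesis
    by (simp add: E2.dual_fs_diff[OF \<Psi> mem] LIM_zero_iff)
qed

lemma continuous_limit_row:
  fixes d :: "nat \<Rightarrow> 'a \<Rightarrow> complex"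
  assumes W: "compactin (weak_top_fs V\<^sub>1 N\<^sub>1) W" "column ` K \<subseteq> W"
    and d: "W \<subseteq> weak_top_fs V\<^sub>1 N\<^sub>1 closure_of (range d)"
  shows "continuous_map (top_of_set E1.weak_star_closure) (weak_top_fs V\<^sub>2 N\<^sub>2) limit_row"
proof (rule continuous_map_into_weak_top)
  fix \<Psi> assume \<Psi>: "\<Psi> \<in> dual_fs V\<^sub>2 N\<^sub>2"
  have W_V: "W \<subseteq> V\<^sub>1"
    using compactin_subset_topspace[OF W(1)] by simp
  have "continuous_on E1.weak_star_closure (\<lambda>\<psi>. \<Psi> (limit_row \<psi>))"
  proof (rule continuous_on_if_sequentially_along[where \<epsilon> = "\<lambda>\<psi> n. \<psi> (d n)"])
    fix \<phi> \<psi> assume \<phi>: "\<And>n. \<phi> n \<in> E1.weak_star_closure" and \<psi>: "\<psi> \<in> E1.weak_star_closure"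
      and lim: "(\<lambda>n k. \<phi> n (d k)) \<longlonglongrightarrow> (\<lambda>k. \<psi> (d k))"
    have "(\<lambda>n. \<phi> n (d k)) \<longlonglongrightarrow> \<psi> (d k)" for k
      using lim by (simp add: tendsto_fun_iff)
    then have "(\<lambda>n. \<phi> n y) \<longlonglongrightarrow> \<psi> y" if "y \<in> W" for y
      by (rule E1.tendsto_on_weak_closure[OF W_V d \<phi> \<psi> _ that])
    then show "(\<lambda>n. \<Psi> (limit_row (\<phi> n))) \<longlonglongrightarrow> \<Psi> (limit_row \<psi>)"
      by (rule limit_row_tendsto[OF W \<phi> \<psi> _ \<Psi>])
  qed (intro continuous_intros)
  then show "continuous_map (top_of_set E1.weak_star_closure) euclidean (\<lambda>\<psi>. \<Psi> (limit_row \<psi>))"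
    by simp
qed (auto simp: limit_row_mem)

lemma rel_weakly_compact_rows:
  fixes d :: "nat \<Rightarrow> 'a \<Rightarrow> complex"
  assumes W: "compactin (weak_top_fs V\<^sub>1 N\<^sub>1) W" "column ` K \<subseteq> W"
    and d: "W \<subseteq> weak_top_fs V\<^sub>1 N\<^sub>1 closure_of (range d)"
  shows "rel_compact_in (weak_top_fs V\<^sub>2 N\<^sub>2) (row ` I)"
proof (rule rel_compact_in_subset_compactin[OF E2.Hausdorff_weak_top])
  show "compactin (weak_top_fs V\<^sub>2 N\<^sub>2) (limit_row ` E1.weak_star_closure)"
    by (rule image_compactin[OF _ continuous_limit_row[OF assms]])
      (simp add: compactin_subtopology E1.compact_weak_star_closure)
  show "row ` I \<subseteq> limit_row ` E1.weak_star_closure"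
  proof clarify
    fix i assume "i \<in> I"
    then show "row i \<in> limit_row ` E1.weak_star_closure"
      using E1.s_in_closure limit_row_s by (metis image_eqI)
  qed
qed

lemma rows_weakly_dense:
  assumes W: "compactin (weak_top_fs V\<^sub>2 N\<^sub>2) W" and "row ` I \<subseteq> W" and "J \<subseteq> I"
    and dense: "s\<^sub>1 ` I \<subseteq> closure (s\<^sub>1 ` J)"
  shows "row ` I \<subseteq> weak_top_fs V\<^sub>2 N\<^sub>2 closure_of (row ` J)"
proof clarify
  fix i assume i: "i \<in> I"
  show "row i \<in> weak_top_fs V\<^sub>2 N\<^sub>2 closure_of (row ` J)"
  proof (rule E2.weak_closure_if_finite_approx[OF W _ row_mem[OF i] order_refl])
    show "row ` J \<subseteq> W"
      using assms(2,3) by blast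
    show "f = row i" if "f \<in> V\<^sub>2" "\<And>k. k \<in> K \<Longrightarrow> s\<^sub>2 k f = s\<^sub>2 k (row i)" for f
      using that by (intro E2.s_separates row_mem[OF i])
    fix F and e :: real assume F: "finite F" "F \<subseteq> K" and "e > 0"
    then obtain \<phi> where "\<phi> \<in> s\<^sub>1 ` J" "\<And>f. f \<in> column ` F \<Longrightarrow> dist (\<phi> f) (s\<^sub>1 i f) < e"
      using closure_fun_finite_approx[of "s\<^sub>1 i" "s\<^sub>1 ` J" "column ` F" e] dense i by blast
    then obtain j where "j \<in> J" "\<And>k. k \<in> F \<Longrightarrow> dist (s\<^sub>1 j (column k)) (s\<^sub>1 i (column k)) < e"
      by blast
    then show "\<exists>f\<in>row ` J. \<forall>k\<in>F. dist (s\<^sub>2 k f) (s\<^sub>2 k (row i)) < e"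
      using F(2) \<open>J \<subseteq> I\<close> i by (intro bexI[of _ "row j"]) (auto simp: subset_iff simp flip: pairing)
  qed
qed

theorem rel_weakly_compact_columns_iff_rows:
  assumes "E1.separable_index"
  shows "rel_compact_in (weak_top_fs V\<^sub>1 N\<^sub>1) (column ` K) \<longleftrightarrow> rel_compact_in (weak_top_fs V\<^sub>2 N\<^sub>2) (row ` I)"
proof
  let ?W = "weak_top_fs V\<^sub>1 N\<^sub>1 closure_of (column ` K)"
  assume "rel_compact_in (weak_top_fs V\<^sub>1 N\<^sub>1) (column ` K)"
  then have W: "compactin (weak_top_fs V\<^sub>1 N\<^sub>1) ?W"
    by (simp add: rel_compact_in_def)
  have columns: "column ` K \<subseteq> ?W"
    using column_mem by (intro closure_of_subset) auto
  then have "?W \<noteq> {}"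
    using E2.index_nonempty by blast
  then obtain d :: "nat \<Rightarrow> 'a \<Rightarrow> complex" where "?W \<subseteq> weak_top_fs V\<^sub>1 N\<^sub>1 closure_of (range d)"
    by (rule E1.weakly_compact_separable[OF W _ assms])
  then show "rel_compact_in (weak_top_fs V\<^sub>2 N\<^sub>2) (row ` I)"
    by (rule rel_weakly_compact_rows[OF W columns])
next
  let ?W = "weak_top_fs V\<^sub>2 N\<^sub>2 closure_of (row ` I)"
  assume "rel_compact_in (weak_top_fs V\<^sub>2 N\<^sub>2) (row ` I)"
  then have W: "compactin (weak_top_fs V\<^sub>2 N\<^sub>2) ?W"
    by (simp add: rel_compact_in_def)
  have rows: "row ` I \<subseteq> ?W"
    using row_mem by (intro closure_of_subset) auto
  obtain j :: "nat \<Rightarrow> 'i" where j: "range j \<subseteq> I" "s\<^sub>1 ` I \<subseteq> closure (s\<^sub>1 ` range j)"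
    using assms unfolding E1.separable_index_def by (elim exE conjE)
  have "row ` I \<subseteq> weak_top_fs V\<^sub>2 N\<^sub>2 closure_of (row ` range j)"
    by (rule rows_weakly_dense[OF W rows j])
  then have "?W \<subseteq> weak_top_fs V\<^sub>2 N\<^sub>2 closure_of (range (\<lambda>n. row (j n)))"
    by (simp add: image_image closure_of_minimal)
  then show "rel_compact_in (weak_top_fs V\<^sub>1 N\<^sub>1) (column ` K)"
    by (rule bounded_kernel.rel_weakly_compact_rows[OF bounded_kernel_swap W rows])
qed

end

subsection \<open>The dual of a normed space\<close>

locale sup_norm_fs =
  fixes V :: "('a \<Rightarrow> complex) set" and N :: "('a \<Rightarrow> complex) \<Rightarrow> real"
    and I :: "'i set" and s :: "'i \<Rightarrow> ('a \<Rightarrow> complex) \<Rightarrow> complex"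
  assumes index_nonempty: "I \<noteq> {}"
    and zero_mem: "0 \<in> V"
    and add_mem: "\<lbrakk>f \<in> V; g \<in> V\<rbrakk> \<Longrightarrow> f + g \<in> V"
    and csmul_mem: "f \<in> V \<Longrightarrow> csmul c f \<in> V"
    and s_add: "\<lbrakk>i \<in> I; f \<in> V; g \<in> V\<rbrakk> \<Longrightarrow> s i (f + g) = s i f + s i g"
    and s_csmul: "\<lbrakk>i \<in> I; f \<in> V\<rbrakk> \<Longrightarrow> s i (csmul c f) = c * s i f"
    and s_outside: "\<lbrakk>i \<in> I; f \<notin> V\<rbrakk> \<Longrightarrow> s i f = 0"
    and s_eq_0: "\<lbrakk>f \<in> V; \<And>i. i \<in> I \<Longrightarrow> s i f = 0\<rbrakk> \<Longrightarrow> f = 0"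
    and s_bdd_above: "f \<in> V \<Longrightarrow> bdd_above ((\<lambda>i. cmod (s i f)) ` I)"
    and norm_eq: "f \<in> V \<Longrightarrow> N f = (SUP i\<in>I. cmod (s i f))"
begin

lemma s_le_norm: "\<lbrakk>i \<in> I; f \<in> V\<rbrakk> \<Longrightarrow> cmod (s i f) \<le> N f"
  by (simp only: norm_eq) (intro cSUP_upper s_bdd_above)

lemma norm_le: "\<lbrakk>f \<in> V; \<And>i. i \<in> I \<Longrightarrow> cmod (s i f) \<le> a\<rbrakk> \<Longrightarrow> N f \<le> a"
  by (simp add: norm_eq cSUP_least index_nonempty)

lemma normed_fs: "normed_fs V N"
proof (unfold_locales; (intro zero_mem add_mem csmul_mem; assumption)?)
  fix f g :: "'a \<Rightarrow> complex" and c
  show "N (f + g) \<le> N f + N g" if "f \<in> V" "g \<in> V"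
    using that norm_triangle_mono[OF s_le_norm[OF _ that(1)] s_le_norm[OF _ that(2)]]
    by (intro norm_le add_mem) (auto simp: s_add)
  show "N (csmul c f) \<le> cmod c * N f" if "f \<in> V"
    using that s_le_norm by (intro norm_le csmul_mem) (auto simp: s_csmul norm_mult mult_left_mono)
  show "f = 0" if "f \<in> V" "N f = 0"
    using that s_le_norm[of _ f] by (intro s_eq_0) auto
qed

lemma norming_familyI:
  assumes "\<And>B u. (\<And>F e. \<lbrakk>finite F; F \<subseteq> I; e > 0\<rbrakk> \<Longrightarrow> \<exists>f\<in>V. N f \<le> B \<and> (\<forall>i\<in>F. dist (s i f) (u i) < e))
    \<Longrightarrow> \<exists>f\<in>V. \<forall>i\<in>I. s i f = u i"
  shows "norming_family V N I s 1"
proof -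
  interpret normed_fs V N
    by (rule normed_fs)
  show ?thesis
  proof
    show "s i \<in> dual_ball_fs V N 1" if "i \<in> I" for i
      using that s_le_norm by (intro dual_ball_fsI) (auto simp: s_add s_csmul s_outside)
    show "N f \<le> 1 * a" if "f \<in> V" "\<And>i. i \<in> I \<Longrightarrow> cmod (s i f) \<le> a" for f a
      using norm_le[OF that] by simp
    show "\<exists>f\<in>V. \<forall>i\<in>I. s i f = u i"
      if "\<And>F e. \<lbrakk>finite F; F \<subseteq> I; e > 0\<rbrakk> \<Longrightarrow> \<exists>f\<in>V. N f \<le> B \<and> (\<forall>i\<in>F. dist (s i f) (u i) < e)" for B u
      using that by (rule assms)
  qed (use index_nonempty in auto)
qed

end

definition dual_eval :: "('b \<Rightarrow> complex) set \<Rightarrow> (('b \<Rightarrow> complex) \<Rightarrow> real) \<Rightarrow> ('b \<Rightarrow> complex)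
    \<Rightarrow> (('b \<Rightarrow> complex) \<Rightarrow> complex) \<Rightarrow> complex" where
  "dual_eval V N f \<phi> = (if \<phi> \<in> dual_fs V N then \<phi> f else 0)"

context normed_fs
begin

lemma zero_in_unit_ball: "0 \<in> unit_ball_fs V N"
  by (simp add: unit_ball_fs_def zero_mem norm_zero)

lemma dual_ball_fs_le_on_unit_ball:
  assumes "\<phi> \<in> dual_ball_fs V N r" "0 \<le> r" "f \<in> unit_ball_fs V N"
  shows "cmod (\<phi> f) \<le> r"
  using dual_ball_fs_le[OF assms(1), of f] mult_left_mono[of "N f" 1 r] assms(2,3) by (auto simp: unit_ball_fs_def)

lemma dual_ball_fs_if_le_on_unit_ball:
  assumes \<phi>: "\<phi> \<in> dual_fs V N" and le: "\<And>f. f \<in> unit_ball_fs V N \<Longrightarrow> cmod (\<phi> f) \<le> r"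
  shows "\<phi> \<in> dual_ball_fs V N r"
proof -
  have "cmod (\<phi> f) \<le> r * N f" if f: "f \<in> V" for f
  proof (cases "N f = 0")
    case True
    then have "f = 0"
      using norm_eq_0 f by blast
    then show ?thesis
      using dual_fs_diff[OF \<phi> zero_mem zero_mem] norm_zero by simp
  next
    case False
    then have "N f > 0"
      using norm_nonneg[OF f] by simp
    then have "csmul (of_real (1 / N f)) f \<in> unit_ball_fs V N"
      using f by (simp add: unit_ball_fs_def csmul_mem norm_csmul norm_divide)
    from le[OF this] show ?thesis
      using \<phi> f \<open>N f > 0\<close> by (simp add: dual_fs_csmul norm_mult norm_divide field_simps)
  qed
  with \<phi> show ?thesis
    by (simp add: dual_ball_fs_def)
qed

lemma dual_fs_bdd_above:
  assumes "\<phi> \<in> dual_fs V N"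
  shows "bdd_above ((\<lambda>f. cmod (\<phi> f)) ` unit_ball_fs V N)"
proof -
  obtain r where "r > 0" "\<phi> \<in> dual_ball_fs V N r"
    using dual_fs_in_dual_ball[OF assms] .
  then show ?thesis
    using dual_ball_fs_le_on_unit_ball by (intro bdd_aboveI2[of _ _ r]) auto
qed

lemma dnorm_fs_le_iff:
  assumes "\<phi> \<in> dual_fs V N" "0 \<le> r"
  shows "dnorm_fs V N \<phi> \<le> r \<longleftrightarrow> \<phi> \<in> dual_ball_fs V N r"
proof -
  have "dnorm_fs V N \<phi> \<le> r \<longleftrightarrow> (\<forall>f\<in>unit_ball_fs V N. cmod (\<phi> f) \<le> r)"
    unfolding dnorm_fs_def using zero_in_unit_ball dual_fs_bdd_above[OF assms(1)] by (intro cSUP_le_iff) auto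
  then show ?thesis
    using dual_ball_fs_if_le_on_unit_ball[OF assms(1)] dual_ball_fs_le_on_unit_ball[OF _ assms(2)] by blast
qed

lemma dual_ball_fs_add:
  assumes "\<phi> \<in> dual_ball_fs V N r" "\<omega> \<in> dual_ball_fs V N t"
  shows "\<phi> + \<omega> \<in> dual_ball_fs V N (r + t)"
proof -
  have "\<phi> \<in> dual_fs V N" "\<omega> \<in> dual_fs V N"
    using assms dual_ball_fs_subset by auto
  then show ?thesis
    using norm_triangle_mono[OF dual_ball_fs_le[OF assms(1)] dual_ball_fs_le[OF assms(2)]]
    by (intro dual_ball_fsI) (auto simp: dual_fs_add dual_fs_csmul dual_fs_zero_outside algebra_simps)
qed

lemma dual_ball_fs_csmul:
  assumes "\<phi> \<in> dual_ball_fs V N r"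
  shows "csmul c \<phi> \<in> dual_ball_fs V N (cmod c * r)"
proof -
  have "\<phi> \<in> dual_fs V N"
    using assms dual_ball_fs_subset by auto
  then show ?thesis
    using mult_left_mono[OF dual_ball_fs_le[OF assms] norm_ge_zero[of c]]
    by (intro dual_ball_fsI)
      (auto simp: dual_fs_add dual_fs_csmul dual_fs_zero_outside norm_mult mult.assoc distrib_left)
qed

lemma sup_norm_fs_dual: "sup_norm_fs (dual_fs V N) (dnorm_fs V N) (unit_ball_fs V N) (dual_eval V N)"
proof
  fix \<phi> \<omega> :: "('a \<Rightarrow> complex) \<Rightarrow> complex" and c
  show "unit_ball_fs V N \<noteq> {}"
    using zero_in_unit_ball by blast
  have "0 \<in> dual_ball_fs V N 0"
    by (rule dual_ball_fsI) auto
  then show "0 \<in> dual_fs V N"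
    using dual_ball_fs_subset by blast
  show add: "\<phi> + \<omega> \<in> dual_fs V N" if "\<phi> \<in> dual_fs V N" "\<omega> \<in> dual_fs V N"
    using that dual_fs_in_dual_ball dual_ball_fs_add dual_ball_fs_subset by (metis subsetD)
  show csmul: "csmul c \<phi> \<in> dual_fs V N" if "\<phi> \<in> dual_fs V N"
    using that dual_fs_in_dual_ball dual_ball_fs_csmul dual_ball_fs_subset by (metis subsetD)
  show "\<phi> = 0" if \<phi>: "\<phi> \<in> dual_fs V N" and "\<And>f. f \<in> unit_ball_fs V N \<Longrightarrow> dual_eval V N f \<phi> = 0"
  proof
    fix f
    have "\<phi> \<in> dual_ball_fs V N 0"
      using that by (intro dual_ball_fs_if_le_on_unit_ball) (auto simp: dual_eval_def)
    then show "\<phi> f = 0 f"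
      using dual_ball_fs_le[of \<phi> V N 0 f] dual_fs_zero_outside[OF \<phi>] by (cases "f \<in> V") auto
  qed
  fix f
  show "dual_eval V N f (\<phi> + \<omega>) = dual_eval V N f \<phi> + dual_eval V N f \<omega>" if "\<phi> \<in> dual_fs V N" "\<omega> \<in> dual_fs V N"
    using that add by (simp add: dual_eval_def)
  show "dual_eval V N f (csmul c \<phi>) = c * dual_eval V N f \<phi>" if "\<phi> \<in> dual_fs V N"
    using that csmul by (simp add: dual_eval_def)
qed (auto simp: dual_eval_def dnorm_fs_def dual_fs_bdd_above)

lemma norming_family_dual: "norming_family (dual_fs V N) (dnorm_fs V N) (unit_ball_fs V N) (dual_eval V N) 1"
proof (rule sup_norm_fs.norming_familyI[OF sup_norm_fs_dual])
  fix B u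
  assume approx: "\<And>F e. \<lbrakk>finite F; F \<subseteq> unit_ball_fs V N; e > 0\<rbrakk> \<Longrightarrow>
    \<exists>\<phi>\<in>dual_fs V N. dnorm_fs V N \<phi> \<le> B \<and> (\<forall>f\<in>F. dist (dual_eval V N f \<phi>) (u f) < e)"
  have "\<exists>\<phi>\<in>dual_ball_fs V N \<bar>B\<bar>. \<forall>f\<in>unit_ball_fs V N. \<phi> f = u f"
  proof (rule compactin_finite_approx_attained)
    show "compactin euclidean (dual_ball_fs V N \<bar>B\<bar>)"
      by (simp add: compact_dual_ball_fs)
    show "continuous_map euclidean euclidean (\<lambda>\<phi>. \<phi> f)" for f :: "'a \<Rightarrow> complex"
      by (simp add: continuous_on_apply)
    show "\<exists>\<phi>\<in>dual_ball_fs V N \<bar>B\<bar>. \<forall>f\<in>F. dist (\<phi> f) (u f) < e"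
      if F: "finite F" "F \<subseteq> unit_ball_fs V N" "e > 0" for F e
    proof -
      obtain \<phi> where "\<phi> \<in> dual_fs V N" "dnorm_fs V N \<phi> \<le> B" "\<And>f. f \<in> F \<Longrightarrow> dist (dual_eval V N f \<phi>) (u f) < e"
        using approx[OF F] by blast
      then show ?thesis
        using dnorm_fs_le_iff[of \<phi> "\<bar>B\<bar>"] by (intro bexI[of _ \<phi>]) (auto simp: dual_eval_def)
    qed
  qed
  then show "\<exists>\<phi>\<in>dual_fs V N. \<forall>f\<in>unit_ball_fs V N. dual_eval V N f \<phi> = u f"
    using dual_ball_fs_subset by (fastforce simp: dual_eval_def)
qed

end

subsection \<open>Compact operators and their adjoints\<close>

definition linear_on_fs :: "('a \<Rightarrow> complex) set \<Rightarrow> (('a \<Rightarrow> complex) \<Rightarrow> ('b \<Rightarrow> complex)) \<Rightarrow> bool" where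
  "linear_on_fs X T \<longleftrightarrow> (\<forall>f\<in>X. \<forall>g\<in>X. T (f + g) = T f + T g) \<and> (\<forall>c. \<forall>f\<in>X. T (csmul c f) = csmul c (T f))"

lemma adjoint_op_csmul: "adjoint_op X T (csmul c \<phi>) = csmul c (adjoint_op X T \<phi>)"
  by (auto simp: adjoint_op_def fun_eq_iff)

lemma bounded_opE:
  assumes "bounded_op X NX V N T" and "normed_fs X NX"
  obtains r where "r \<ge> 0" "\<And>f. f \<in> X \<Longrightarrow> T f \<in> V" "\<And>f. f \<in> X \<Longrightarrow> N (T f) \<le> r * NX f"
proof -
  obtain r where T: "\<And>f. f \<in> X \<Longrightarrow> T f \<in> V" and r: "\<And>f. f \<in> X \<Longrightarrow> N (T f) \<le> r * NX f"
    using assms(1) unfolding bounded_op_def by blast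
  have "N (T f) \<le> \<bar>r\<bar> * NX f" if "f \<in> X" for f
    using r[OF that] mult_right_mono[OF abs_ge_self normed_fs.norm_nonneg[OF assms(2) that], of r] by linarith
  with T show ?thesis
    using that[of "\<bar>r\<bar>"] by simp
qed

lemma adjoint_op_in_dual_ball:
  assumes X: "normed_fs X NX" and T: "linear_on_fs X T" "\<And>f. f \<in> X \<Longrightarrow> T f \<in> V" "\<And>f. f \<in> X \<Longrightarrow> N (T f) \<le> r * NX f"
    and \<phi>: "\<phi> \<in> dual_ball_fs V N t" and "0 \<le> t"
  shows "adjoint_op X T \<phi> \<in> dual_ball_fs X NX (t * r)"
proof -
  interpret X: normed_fs X NX
    by (rule X)
  have dual: "\<phi> \<in> dual_fs V N"
    using \<phi> dual_ball_fs_subset by blast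
  show ?thesis
  proof (rule dual_ball_fsI)
    fix f assume f: "f \<in> X"
    have "cmod (\<phi> (T f)) \<le> t * N (T f)"
      by (rule dual_ball_fs_le[OF \<phi> T(2)[OF f]])
    also have "\<dots> \<le> t * (r * NX f)"
      using T(3)[OF f] \<open>0 \<le> t\<close> by (rule mult_left_mono)
    finally show "cmod (adjoint_op X T \<phi> f) \<le> t * r * NX f"
      using f by (simp add: adjoint_op_def)
  qed (use T(1,2) dual in \<open>auto simp: adjoint_op_def linear_on_fs_def X.add_mem X.csmul_mem dual_fs_add dual_fs_csmul\<close>)
qed

context norming_family
begin

lemma bounded_kernel_adjoint:
  assumes X: "normed_fs X NX" and T: "bounded_op X NX V N T" "linear_on_fs X T"
  obtains r where "bounded_kernel V N I s C (dual_fs X NX) (dnorm_fs X NX) (unit_ball_fs X NX) (dual_eval X NX) 1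
    T (\<lambda>i. adjoint_op X T (s i)) r"
proof -
  interpret X: normed_fs X NX
    by (rule X)
  interpret D: norming_family "dual_fs X NX" "dnorm_fs X NX" "unit_ball_fs X NX" "dual_eval X NX" 1
    by (rule X.norming_family_dual)
  obtain r where "r \<ge> 0" and mem: "\<And>f. f \<in> X \<Longrightarrow> T f \<in> V" and r: "\<And>f. f \<in> X \<Longrightarrow> N (T f) \<le> r * NX f"
    using bounded_opE[OF T(1) X] by blast
  have adjoint: "adjoint_op X T (s i) \<in> dual_ball_fs X NX r" if "i \<in> I" for i
    using adjoint_op_in_dual_ball[OF X T(2) mem r s_in_dual_ball[OF that]] by simp
  then have adjoint_dual: "adjoint_op X T (s i) \<in> dual_fs X NX" if "i \<in> I" for i
    using that dual_ball_fs_subset by blast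
  have "bounded_kernel V N I s C (dual_fs X NX) (dnorm_fs X NX) (unit_ball_fs X NX) (dual_eval X NX) 1
    T (\<lambda>i. adjoint_op X T (s i)) r"
  proof
    fix f assume "f \<in> unit_ball_fs X NX"
    then have f: "f \<in> X" "NX f \<le> 1"
      by (simp_all add: unit_ball_fs_def)
    show "T f \<in> V"
      by (rule mem[OF f(1)])
    show "N (T f) \<le> r"
      using r[OF f(1)] mult_left_mono[OF f(2) \<open>r \<ge> 0\<close>] by simp
    show "s i (T f) = dual_eval X NX f (adjoint_op X T (s i))" if "i \<in> I" for i
      using adjoint_dual[OF that] f(1) by (simp add: dual_eval_def adjoint_op_def)
  next
    fix i assume "i \<in> I"
    then show "adjoint_op X T (s i) \<in> dual_fs X NX" "dnorm_fs X NX (adjoint_op X T (s i)) \<le> r"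
      using adjoint adjoint_dual X.dnorm_fs_le_iff \<open>r \<ge> 0\<close> by auto
  qed
  then show ?thesis
    using that by blast
qed

theorem
  assumes X: "normed_fs X NX" and T: "bounded_op X NX V N T" "linear_on_fs X T"
  shows compact_op_iff_adjoint: "compact_op X NX V N T \<longleftrightarrow>
      rel_compact_in (norm_top_fs (dual_fs X NX) (dnorm_fs X NX)) ((\<lambda>i. adjoint_op X T (s i)) ` I)"
    and weakly_compact_op_iff_adjoint: "separable_index \<Longrightarrow> weakly_compact_op X NX V N T \<longleftrightarrow>
      rel_compact_in (weak_top_fs (dual_fs X NX) (dnorm_fs X NX)) ((\<lambda>i. adjoint_op X T (s i)) ` I)"
proof -
  obtain r where "bounded_kernel V N I s C (dual_fs X NX) (dnorm_fs X NX) (unit_ball_fs X NX) (dual_eval X NX) 1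
    T (\<lambda>i. adjoint_op X T (s i)) r"
    using bounded_kernel_adjoint[OF assms] .
  then interpret bounded_kernel V N I s C "dual_fs X NX" "dnorm_fs X NX" "unit_ball_fs X NX" "dual_eval X NX" 1
    T "\<lambda>i. adjoint_op X T (s i)" r .
  show "compact_op X NX V N T \<longleftrightarrow>
      rel_compact_in (norm_top_fs (dual_fs X NX) (dnorm_fs X NX)) ((\<lambda>i. adjoint_op X T (s i)) ` I)"
    unfolding compact_op_def by (rule rel_compact_columns_iff_rows)
  show "weakly_compact_op X NX V N T \<longleftrightarrow>
      rel_compact_in (weak_top_fs (dual_fs X NX) (dnorm_fs X NX)) ((\<lambda>i. adjoint_op X T (s i)) ` I)" if separable_index
    unfolding weakly_compact_op_def by (rule rel_weakly_compact_columns_iff_rows[OF that])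
qed

lemma separable_indexI:
  fixes p :: "'p::{metric_space, second_countable_topology} \<Rightarrow> 'i"
  assumes "countable E" and I: "I = E \<union> p ` A" and cont: "continuous_on A (\<lambda>z. s (p z))"
  shows separable_index
proof -
  obtain D where D: "countable D" "D \<subseteq> A" "A \<subseteq> closure D"
    using separable by blast
  let ?J = "E \<union> p ` D"
  have "A \<subseteq> top_of_set A closure_of D"
    using D(2,3) by (simp add: closure_of_subtopology Int_absorb1)
  moreover have "(\<lambda>z. s (p z)) ` (top_of_set A closure_of D) \<subseteq> closure ((\<lambda>z. s (p z)) ` D)"
    using continuous_map_image_closure_subset[of "top_of_set A" euclidean "\<lambda>z. s (p z)" D] cont by simp
  ultimately have "s ` p ` A \<subseteq> closure (s ` ?J)"
    using closure_mono[of "(\<lambda>z. s (p z)) ` D" "s ` ?J"] by blast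
  moreover have "s ` E \<subseteq> closure (s ` ?J)"
    using closure_subset by fast
  ultimately have dense: "s ` I \<subseteq> closure (s ` ?J)"
    unfolding I by blast
  then have "?J \<noteq> {}"
    using index_nonempty by auto
  moreover have "countable ?J" "?J \<subseteq> I"
    using assms(1) D I by auto
  ultimately show ?thesis
    using dense unfolding separable_index_def by (intro exI[of _ "from_nat_into ?J"]) (simp add: range_from_nat_into)
qed

end

subsection \<open>Weighted spaces of holomorphic functions\<close>

lemma Hol_zero: "0 \<in> Hol"
  by (simp add: Hol_def zero_fun_def)

lemma Hol_add: "\<lbrakk>f \<in> Hol; g \<in> Hol\<rbrakk> \<Longrightarrow> f + g \<in> Hol"
  by (auto simp: Hol_def plus_fun_def intro: holomorphic_on_add)

lemma Hol_csmul: "f \<in> Hol \<Longrightarrow> csmul c f \<in> Hol"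
  by (auto simp: Hol_def csmul_def intro!: holomorphic_intros)

lemma Hol_eqI: "\<lbrakk>f \<in> Hol; g \<in> Hol; \<And>z. z \<in> disk \<Longrightarrow> f z = g z\<rbrakk> \<Longrightarrow> f = g"
  by (auto simp: Hol_def fun_eq_iff) (metis dist_0_norm)

lemma Hol_continuous: "f \<in> Hol \<Longrightarrow> continuous_on disk f"
  by (simp add: Hol_def holomorphic_on_imp_continuous_on)

lemma Hol_field_differentiable: "\<lbrakk>f \<in> Hol; z \<in> disk\<rbrakk> \<Longrightarrow> f field_differentiable at z"
  by (auto simp: Hol_def intro: holomorphic_on_imp_differentiable_at)

lemma Hv_imp_Hol: "f \<in> Hv v \<Longrightarrow> f \<in> Hol"
  by (simp add: Hv_def)

lemma Hv_le: "\<lbrakk>f \<in> Hv v; z \<in> disk\<rbrakk> \<Longrightarrow> v z * cmod (f z) \<le> Hv_norm v f"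
  unfolding Hv_norm_def by (intro cSUP_upper) (auto simp: Hv_def)

lemma Hv_ballI:
  assumes "f \<in> Hol" "\<And>z. z \<in> disk \<Longrightarrow> v z * cmod (f z) \<le> B"
  shows "f \<in> Hv v" and "Hv_norm v f \<le> B"
  using assms unfolding Hv_def Hv_norm_def by (auto intro!: bdd_aboveI2 cSUP_least)

lemma typical_weight_pos: "\<lbrakk>typical_weight v; z \<in> disk\<rbrakk> \<Longrightarrow> 0 < v z"
  by (simp add: typical_weight_def)

definition Hv_eval :: "(complex \<Rightarrow> real) \<Rightarrow> complex \<Rightarrow> (complex \<Rightarrow> complex) \<Rightarrow> complex" where
  "Hv_eval v z = csmul (complex_of_real (v z)) (KH v z)"

lemma Hv_eval_eq: "f \<in> Hv v \<Longrightarrow> Hv_eval v z f = complex_of_real (v z) * f z"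
  and Hv_eval_outside: "f \<notin> Hv v \<Longrightarrow> Hv_eval v z f = 0"
  by (simp_all add: Hv_eval_def KH_def)

lemma norm_Hv_eval: "\<lbrakk>typical_weight v; z \<in> disk; f \<in> Hv v\<rbrakk> \<Longrightarrow> cmod (Hv_eval v z f) = v z * cmod (f z)"
  using typical_weight_pos[of v z] by (simp add: Hv_eval_eq norm_mult)

lemma continuous_on_Hv_eval:
  assumes "typical_weight v"
  shows "continuous_on disk (Hv_eval v)"
proof (rule continuous_on_coordinatewise_then_product)
  fix f
  show "continuous_on disk (\<lambda>z. Hv_eval v z f)"
  proof (cases "f \<in> Hv v")
    case True
    have "continuous_on disk v"
      using assms by (simp add: typical_weight_def)
    with True show ?thesis
      by (simp add: Hv_eval_eq) (intro continuous_intros Hol_continuous Hv_imp_Hol)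
  qed (simp add: Hv_eval_outside)
qed

lemma sup_norm_fs_Hv:
  assumes v: "typical_weight v"
  shows "sup_norm_fs (Hv v) (Hv_norm v) disk (Hv_eval v)"
proof
  fix f g :: "complex \<Rightarrow> complex" and c
  show "0 \<in> Hv v"
    by (rule Hv_ballI[OF Hol_zero, of v 0]) simp
  show add: "f + g \<in> Hv v" if "f \<in> Hv v" "g \<in> Hv v"
  proof (rule Hv_ballI)
    fix z assume z: "z \<in> disk"
    have "v z * cmod ((f + g) z) \<le> v z * (cmod (f z) + cmod (g z))"
      using typical_weight_pos[OF v z] by (intro mult_left_mono) (auto simp: norm_triangle_ineq)
    then show "v z * cmod ((f + g) z) \<le> Hv_norm v f + Hv_norm v g"
      using Hv_le[OF that(1) z] Hv_le[OF that(2) z] by (simp add: distrib_left)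
  qed (use that in \<open>simp add: Hol_add Hv_imp_Hol\<close>)
  show csmul: "csmul c f \<in> Hv v" if "f \<in> Hv v"
  proof (rule Hv_ballI)
    fix z assume "z \<in> disk"
    then show "v z * cmod (csmul c f z) \<le> cmod c * Hv_norm v f"
      using mult_left_mono[OF Hv_le[OF that], of z "cmod c"] by (simp add: norm_mult mult_ac)
  qed (use that in \<open>simp add: Hol_csmul Hv_imp_Hol\<close>)
  show "Hv_eval v z (f + g) = Hv_eval v z f + Hv_eval v z g" if "f \<in> Hv v" "g \<in> Hv v" for z
    using that add by (simp add: Hv_eval_eq distrib_left)
  show "Hv_eval v z (csmul c f) = c * Hv_eval v z f" if "f \<in> Hv v" for z
    using that csmul by (simp add: Hv_eval_eq)
  show "f = 0" if f: "f \<in> Hv v" and "\<And>z. z \<in> disk \<Longrightarrow> Hv_eval v z f = 0"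
  proof (rule Hol_eqI[OF Hv_imp_Hol[OF f] Hol_zero])
    fix z assume "z \<in> disk"
    then show "f z = 0 z"
      using that(2)[of z] typical_weight_pos[OF v, of z] by (simp add: Hv_eval_eq[OF f])
  qed
  show "bdd_above ((\<lambda>z. cmod (Hv_eval v z f)) ` disk)" if "f \<in> Hv v"
    using that v by (simp add: norm_Hv_eval Hv_def cong: image_cong_simp)
  show "Hv_norm v f = (SUP z\<in>disk. cmod (Hv_eval v z f))" if "f \<in> Hv v"
    using that v by (simp add: norm_Hv_eval Hv_norm_def cong: SUP_cong_simp)
qed (simp_all add: Hv_eval_outside)

lemma Hv_ball_locally_bounded:
  assumes v: "typical_weight v" and K: "compact K" "K \<subseteq> disk"
  shows "\<exists>M. \<forall>f\<in>{f \<in> Hv v. Hv_norm v f \<le> B}. \<forall>z\<in>K. cmod (f z) \<le> M"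
proof (cases "K = {}")
  case False
  have "continuous_on K v"
    using v K continuous_on_subset unfolding typical_weight_def by blast
  then obtain x where x: "x \<in> K" "\<And>z. z \<in> K \<Longrightarrow> v x \<le> v z"
    using continuous_attains_inf[OF K(1) False] by blast
  have "v x > 0"
    using x(1) K v typical_weight_pos by blast
  have "cmod (f z) \<le> B / v x" if f: "f \<in> Hv v" "Hv_norm v f \<le> B" and z: "z \<in> K" for f z
  proof -
    have "v x * cmod (f z) \<le> v z * cmod (f z)"
      using x(2)[OF z] by (intro mult_right_mono) auto
    also have "\<dots> \<le> B"
      using Hv_le[OF f(1)] f(2) z K(2) by fastforce
    finally show ?thesis
      using \<open>v x > 0\<close> by (simp add: field_simps)
  qed
  then show ?thesis by blast
qed auto

lemma Hv_ball_Montel: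
  assumes v: "typical_weight v" and f: "\<And>n. f n \<in> Hv v" "\<And>n. Hv_norm v (f n) \<le> B"
  shows "\<exists>g r. g \<in> Hv v \<and> Hv_norm v g \<le> B \<and> strict_mono (r :: nat \<Rightarrow> nat) \<and>
    (\<forall>z\<in>disk. (\<lambda>n. f (r n) z) \<longlonglongrightarrow> g z)"
proof -
  let ?G = "{f \<in> Hv v. Hv_norm v f \<le> B}"
  have hol: "\<And>h. h \<in> ?G \<Longrightarrow> h holomorphic_on disk"
    by (simp add: Hv_def Hol_def)
  have range_f: "range f \<subseteq> ?G"
    using f by blast
  obtain g0 r where g0: "g0 holomorphic_on disk" and r: "strict_mono (r :: nat \<Rightarrow> nat)"
    and lim: "\<And>z. z \<in> disk \<Longrightarrow> (\<lambda>n. f (r n) z) \<longlonglongrightarrow> g0 z"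
  proof (rule Montel[OF open_ball hol Hv_ball_locally_bounded[OF v] range_f])
    fix g0 r
    assume "g0 holomorphic_on disk" "strict_mono (r :: nat \<Rightarrow> nat)"
      "\<And>z. z \<in> disk \<Longrightarrow> (\<lambda>n. f (r n) z) \<longlonglongrightarrow> g0 z"
    then show thesis
      by (rule that)
  qed
  define g where "g z = (if z \<in> disk then g0 z else 0)" for z
  have g: "g \<in> Hol"
    using holomorphic_transform[OF g0, of g] by (simp add: Hol_def g_def)
  have bound: "v z * cmod (g z) \<le> B" if z: "z \<in> disk" for z
  proof (rule LIMSEQ_le_const2)
    show "(\<lambda>n. v z * cmod (f (r n) z)) \<longlonglongrightarrow> v z * cmod (g z)"
      using lim[OF z] z by (intro tendsto_intros) (simp add: g_def)
    show "\<exists>M. \<forall>n\<ge>M. v z * cmod (f (r n) z) \<le> B"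
      using order_trans[OF Hv_le[OF f(1) z] f(2)] by blast
  qed
  have "\<forall>z\<in>disk. (\<lambda>n. f (r n) z) \<longlonglongrightarrow> g z"
    using lim by (simp add: g_def)
  with r Hv_ballI[OF g bound] show ?thesis
    by blast
qed

lemma Hv_eval_approx_attained_countable:
  assumes v: "typical_weight v" and A: "countable A" "A \<noteq> {}" "A \<subseteq> disk"
    and approx: "\<And>F e. \<lbrakk>finite F; F \<subseteq> A; e > 0\<rbrakk> \<Longrightarrow>
      \<exists>f\<in>Hv v. Hv_norm v f \<le> B \<and> (\<forall>z\<in>F. dist (Hv_eval v z f) (u z) < e)"
  shows "\<exists>g\<in>Hv v. \<forall>z\<in>A. Hv_eval v z g = u z"
proof -
  define q where "q = from_nat_into A"
  have q: "range q = A"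
    unfolding q_def by (rule range_from_nat_into[OF A(2,1)])
  have "\<exists>f. f \<in> Hv v \<and> Hv_norm v f \<le> B \<and> (\<forall>m\<le>n. dist (Hv_eval v (q m) f) (u (q m)) < inverse (real (Suc n)))" for n
    using approx[of "q ` {..n}" "inverse (real (Suc n))"] q by auto
  then obtain f where f: "\<And>n. f n \<in> Hv v" "\<And>n. Hv_norm v (f n) \<le> B"
    and near: "\<And>m n. m \<le> n \<Longrightarrow> dist (Hv_eval v (q m) (f n)) (u (q m)) < inverse (real (Suc n))"
    by metis
  obtain g r where g: "g \<in> Hv v" and r: "strict_mono (r :: nat \<Rightarrow> nat)"
    and lim: "\<And>z. z \<in> disk \<Longrightarrow> (\<lambda>n. f (r n) z) \<longlonglongrightarrow> g z"
    using Hv_ball_Montel[of v f B, OF v f] by blast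
  have "Hv_eval v (q m) g = u (q m)" for m
  proof (rule LIMSEQ_unique)
    have "q m \<in> disk"
      using q A(3) by blast
    then show "(\<lambda>n. Hv_eval v (q m) (f (r n))) \<longlonglongrightarrow> Hv_eval v (q m) g"
      using lim by (simp add: Hv_eval_eq f g) (intro tendsto_intros)
    have "(\<lambda>n. Hv_eval v (q m) (f n)) \<longlonglongrightarrow> u (q m)"
    proof (rule metric_tendsto_imp_tendsto[OF LIMSEQ_inverse_real_of_nat])
      show "\<forall>\<^sub>F n in sequentially. dist (Hv_eval v (q m) (f n)) (u (q m)) \<le> dist (inverse (real (Suc n))) 0"
        using eventually_ge_at_top[of m]
        by eventually_elim (use near in \<open>simp add: less_imp_le del: of_nat_Suc\<close>)
    qed
    from LIMSEQ_subseq_LIMSEQ[OF this r] show "(\<lambda>n. Hv_eval v (q m) (f (r n))) \<longlonglongrightarrow> u (q m)"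
      by (simp add: o_def)
  qed
  with g q show ?thesis
    by blast
qed

lemma Hv_eval_approx_attained:
  assumes v: "typical_weight v"
    and approx: "\<And>F e. \<lbrakk>finite F; F \<subseteq> disk; e > 0\<rbrakk> \<Longrightarrow>
      \<exists>f\<in>Hv v. Hv_norm v f \<le> B \<and> (\<forall>z\<in>F. dist (Hv_eval v z f) (u z) < e)"
  shows "\<exists>g\<in>Hv v. \<forall>z\<in>disk. Hv_eval v z g = u z"
proof -
  obtain D :: "complex set" where D: "countable D" "D \<subseteq> disk" "disk \<subseteq> closure D"
    using separable by blast
  have attained: "\<exists>g\<in>Hv v. \<forall>z\<in>insert w D. Hv_eval v z g = u z" if "w \<in> disk" for w
    using that D(1,2) by (intro Hv_eval_approx_attained_countable[OF v, where B = B] approx) auto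
  obtain g where g: "g \<in> Hv v" "\<And>z. z \<in> D \<Longrightarrow> Hv_eval v z g = u z"
    using attained[of 0] by auto
  have "Hv_eval v w g = u w" if w: "w \<in> disk" for w
  proof -
    obtain h where h: "h \<in> Hv v" "\<And>z. z \<in> insert w D \<Longrightarrow> Hv_eval v z h = u z"
      using attained[OF w] by auto
    have cont: "continuous_on disk (\<lambda>z. Hv_eval v z f)" for f
      using continuous_on_Hv_eval[OF v] by (rule continuous_on_product_then_coordinatewise)
    have "w \<in> top_of_set disk closure_of D"
      using D(2,3) w by (auto simp: closure_of_subtopology Int_absorb1)
    then have "Hv_eval v w g = Hv_eval v w h"
      by (rule forall_in_closure_of_eq[OF _ Hausdorff_space_euclidean]) (use cont g(2) h(2) in auto)
    then show ?thesis
      using h(2) by simp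
  qed
  with g(1) show ?thesis
    by blast
qed

lemma norming_family_Hv:
  assumes "typical_weight v"
  shows "norming_family (Hv v) (Hv_norm v) disk (Hv_eval v) 1"
  using sup_norm_fs_Hv[OF assms] Hv_eval_approx_attained[OF assms] by (rule sup_norm_fs.norming_familyI)

subsection \<open>Bloch-type spaces\<close>

definition Hol_deriv :: "(complex \<Rightarrow> complex) \<Rightarrow> complex \<Rightarrow> complex" where
  "Hol_deriv f z = (if z \<in> disk then deriv f z else 0)"

lemma Hol_deriv_Hol: "f \<in> Hol \<Longrightarrow> Hol_deriv f \<in> Hol"
  using holomorphic_transform[of "deriv f" disk "Hol_deriv f"]
  by (auto simp: Hol_def Hol_deriv_def intro: holomorphic_deriv)

lemma Hol_deriv_zero: "Hol_deriv 0 = 0"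
  by (simp add: Hol_deriv_def zero_fun_def fun_eq_iff)

lemma Hol_deriv_add: "\<lbrakk>f \<in> Hol; g \<in> Hol\<rbrakk> \<Longrightarrow> Hol_deriv (f + g) = Hol_deriv f + Hol_deriv g"
  using Hol_field_differentiable[of f] Hol_field_differentiable[of g]
  by (auto simp: fun_eq_iff Hol_deriv_def plus_fun_def)

lemma Hol_deriv_csmul: "f \<in> Hol \<Longrightarrow> Hol_deriv (csmul c f) = csmul c (Hol_deriv f)"
  using Hol_field_differentiable[of f] by (auto simp: fun_eq_iff Hol_deriv_def csmul_def)

lemma Hol_primitive:
  assumes "g \<in> Hol"
  obtains f where "f \<in> Hol" "f 0 = c" "Hol_deriv f = g"
proof -
  have g: "g holomorphic_on disk" "\<And>z. z \<notin> disk \<Longrightarrow> g z = 0"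
    using assms by (auto simp: Hol_def)
  obtain P where P: "\<And>z. z \<in> disk \<Longrightarrow> (P has_field_derivative g z) (at z within disk)"
    using holomorphic_convex_primitive'[OF convex_ball open_ball g(1)] by blast
  define f where "f z = (if z \<in> disk then P z - P 0 + c else 0)" for z
  have deriv: "(f has_field_derivative g z) (at z)" if "z \<in> disk" for z
  proof (rule has_field_derivative_transform_within_open[where S = disk])
    show "((\<lambda>z. P z - P 0 + c) has_field_derivative g z) (at z)"
      using P[OF that] that by (auto simp: at_within_open[OF that open_ball] intro!: derivative_eq_intros)
  qed (use that in \<open>auto simp: f_def\<close>)
  have "f holomorphic_on disk"
    using deriv has_field_derivative_at_within unfolding holomorphic_on_def field_differentiable_def by blast
  then have "f \<in> Hol"
    by (simp add: Hol_def f_def)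
  moreover have "Hol_deriv f = g"
  proof
    fix z show "Hol_deriv f z = g z"
      using DERIV_imp_deriv[OF deriv[of z]] g(2)[of z] by (auto simp: Hol_deriv_def)
  qed
  ultimately show ?thesis
    using that[of f] by (simp add: f_def)
qed

lemma Hol_eq_if_Hol_deriv_zero:
  assumes "f \<in> Hol" "f 0 = 0" "Hol_deriv f = 0"
  shows "f = 0"
proof (rule Hol_eqI[OF assms(1) Hol_zero])
  fix z :: complex assume z: "z \<in> disk"
  have "(f has_field_derivative 0) (at w within disk)" if "w \<in> disk" for w
  proof -
    have "deriv f w = 0"
      using fun_cong[OF assms(3), of w] that by (simp add: Hol_deriv_def)
    then have "(f has_field_derivative 0) (at w)"
      using field_differentiable_derivI[OF Hol_field_differentiable[OF assms(1) that]] by simp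
    then show ?thesis
      by (rule has_field_derivative_at_within)
  qed
  then obtain c where "\<And>w. w \<in> disk \<Longrightarrow> f w = c"
    using has_field_derivative_zero_constant[OF convex_ball] by blast
  then show "f z = 0 z"
    using z assms(2) by (metis centre_in_ball zero_fun_apply zero_less_one)
qed

lemma Bv_iff: "f \<in> Bv v \<longleftrightarrow> f \<in> Hol \<and> Hol_deriv f \<in> Hv v"
proof -
  have "(\<lambda>z. v z * cmod (Hol_deriv f z)) ` disk = (\<lambda>z. v z * cmod (deriv f z)) ` disk"
    by (intro image_cong) (auto simp: Hol_deriv_def)
  then show ?thesis
    using Hol_deriv_Hol by (auto simp: Bv_def Hv_def)
qed

lemma Bv_imp_Hol: "f \<in> Bv v \<Longrightarrow> f \<in> Hol"
  by (simp add: Bv_iff)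

lemma Bv_imp_Hol_deriv_Hv: "f \<in> Bv v \<Longrightarrow> Hol_deriv f \<in> Hv v"
  by (simp add: Bv_iff)

lemma Bv_norm_eq: "Bv_norm v f = cmod (f 0) + Hv_norm v (Hol_deriv f)"
  unfolding Bv_norm_def Hv_norm_def by (simp add: Hol_deriv_def)

text \<open>Evaluation at \<open>0\<close> is included because derivative evaluations vanish on constants.\<close>
definition Bv_eval :: "(complex \<Rightarrow> real) \<Rightarrow> complex option \<Rightarrow> (complex \<Rightarrow> complex) \<Rightarrow> complex" where
  "Bv_eval v i = (case i of
     None \<Rightarrow> (\<lambda>g. if g \<in> Bv v then g 0 else 0)
   | Some z \<Rightarrow> csmul (complex_of_real (v z)) (KB1 v z))"

abbreviation Bv_index :: "complex option set" where
  "Bv_index \<equiv> insert None (Some ` disk)"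

lemma Bv_eval_None: "f \<in> Bv v \<Longrightarrow> Bv_eval v None f = f 0"
  by (simp add: Bv_eval_def)

lemma Bv_eval_Some: "\<lbrakk>f \<in> Bv v; z \<in> disk\<rbrakk> \<Longrightarrow> Bv_eval v (Some z) f = Hv_eval v z (Hol_deriv f)"
  by (simp add: Bv_eval_def KB1_def Hv_eval_eq Bv_imp_Hol_deriv_Hv Hol_deriv_def)

lemma Bv_eval_outside: "f \<notin> Bv v \<Longrightarrow> Bv_eval v i f = 0"
  by (cases i) (simp_all add: Bv_eval_def KB1_def)

lemma continuous_on_Bv_eval:
  assumes "typical_weight v"
  shows "continuous_on disk (\<lambda>z. Bv_eval v (Some z))"
proof (rule continuous_on_coordinatewise_then_product)
  fix f
  show "continuous_on disk (\<lambda>z. Bv_eval v (Some z) f)"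
  proof (cases "f \<in> Bv v")
    case True
    have "continuous_on disk (\<lambda>z. Hv_eval v z (Hol_deriv f))"
      using continuous_on_Hv_eval[OF assms] by (rule continuous_on_product_then_coordinatewise)
    moreover have "continuous_on disk (\<lambda>z. Bv_eval v (Some z) f) \<longleftrightarrow> continuous_on disk (\<lambda>z. Hv_eval v z (Hol_deriv f))"
      using True by (intro continuous_on_cong refl Bv_eval_Some)
    ultimately show ?thesis
      by blast
  qed (simp add: Bv_eval_outside)
qed

lemma normed_fs_Bv:
  assumes "typical_weight v"
  shows "normed_fs (Bv v) (Bv_norm v)"
proof -
  interpret H: normed_fs "Hv v" "Hv_norm v"
    by (rule sup_norm_fs.normed_fs[OF sup_norm_fs_Hv[OF assms]])
  show ?thesis
  proof
    show "0 \<in> Bv v"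
      by (simp only: Bv_iff Hol_deriv_zero H.zero_mem Hol_zero simp_thms)
    show "f + g \<in> Bv v" if "f \<in> Bv v" "g \<in> Bv v" for f g
      using that by (simp add: Bv_iff Hol_add Hol_deriv_add H.add_mem)
    show "csmul c f \<in> Bv v" if "f \<in> Bv v" for c f
      using that by (simp add: Bv_iff Hol_csmul Hol_deriv_csmul H.csmul_mem)
    show "Bv_norm v (f + g) \<le> Bv_norm v f + Bv_norm v g" if "f \<in> Bv v" "g \<in> Bv v" for f g
      using H.norm_triangle[OF that[THEN Bv_imp_Hol_deriv_Hv]] norm_triangle_ineq[of "f 0" "g 0"]
      by (simp add: Bv_norm_eq Hol_deriv_add that[THEN Bv_imp_Hol])
    show "Bv_norm v (csmul c f) \<le> cmod c * Bv_norm v f" if "f \<in> Bv v" for c f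
      using that
      by (simp add: Bv_norm_eq Hol_deriv_csmul Bv_imp_Hol H.norm_csmul Bv_imp_Hol_deriv_Hv norm_mult distrib_left)
    show "f = 0" if f: "f \<in> Bv v" and "Bv_norm v f = 0" for f
    proof (rule Hol_eq_if_Hol_deriv_zero[OF Bv_imp_Hol[OF f]])
      have "cmod (f 0) = 0 \<and> Hv_norm v (Hol_deriv f) = 0"
        using that(2) H.norm_nonneg[OF Bv_imp_Hol_deriv_Hv[OF f]] norm_ge_zero[of "f 0"] unfolding Bv_norm_eq by linarith
      then show "f 0 = 0" "Hol_deriv f = 0"
        using H.norm_eq_0[OF Bv_imp_Hol_deriv_Hv[OF f]] by auto
    qed
  qed
qed

lemma Bv_eval_in_dual_ball:
  assumes "typical_weight v" and i: "i \<in> Bv_index"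
  shows "Bv_eval v i \<in> dual_ball_fs (Bv v) (Bv_norm v) 1"
proof -
  interpret H: norming_family "Hv v" "Hv_norm v" disk "Hv_eval v" 1
    by (rule norming_family_Hv[OF assms(1)])
  interpret normed_fs "Bv v" "Bv_norm v"
    by (rule normed_fs_Bv[OF assms(1)])
  note Bv_D = Bv_imp_Hol Bv_imp_Hol_deriv_Hv
  show ?thesis
  proof (rule dual_ball_fsI)
    show "Bv_eval v i (f + g) = Bv_eval v i f + Bv_eval v i g" if "f \<in> Bv v" "g \<in> Bv v" for f g
      using i that add_mem
      by (auto simp: Bv_eval_None Bv_eval_Some Hol_deriv_add Bv_D dual_fs_add[OF H.s_in_dual])
    show "Bv_eval v i (csmul c f) = c * Bv_eval v i f" if "f \<in> Bv v" for c f
      using i that csmul_mem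
      by (auto simp: Bv_eval_None Bv_eval_Some Hol_deriv_csmul Bv_D dual_fs_csmul[OF H.s_in_dual])
    show "cmod (Bv_eval v i f) \<le> 1 * Bv_norm v f" if f: "f \<in> Bv v" for f
      using i f H.norm_nonneg[OF Bv_imp_Hol_deriv_Hv[OF f]] H.s_le_norm[OF _ Bv_imp_Hol_deriv_Hv[OF f]]
      by (auto simp: Bv_eval_None Bv_eval_Some Bv_norm_eq add_increasing)
  qed (rule Bv_eval_outside)
qed

lemma Bv_eval_approx_attained:
  assumes v: "typical_weight v"
    and approx: "\<And>F e. \<lbrakk>finite F; F \<subseteq> Bv_index; e > 0\<rbrakk> \<Longrightarrow>
      \<exists>f\<in>Bv v. Bv_norm v f \<le> B \<and> (\<forall>i\<in>F. dist (Bv_eval v i f) (u i) < e)"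
  shows "\<exists>f\<in>Bv v. \<forall>i\<in>Bv_index. Bv_eval v i f = u i"
proof -
  have "\<exists>g\<in>Hv v. \<forall>z\<in>disk. Hv_eval v z g = u (Some z)"
  proof (rule Hv_eval_approx_attained[OF v])
    fix F :: "complex set" and e :: real assume F: "finite F" "F \<subseteq> disk" "e > 0"
    then obtain f where f: "f \<in> Bv v" "Bv_norm v f \<le> B" "\<forall>i\<in>Some ` F. dist (Bv_eval v i f) (u i) < e"
      using approx[of "Some ` F" e] by blast
    then have "Hv_norm v (Hol_deriv f) \<le> B"
      using norm_ge_zero[of "f 0"] unfolding Bv_norm_eq by linarith
    moreover have "dist (Hv_eval v z (Hol_deriv f)) (u (Some z)) < e" if "z \<in> F" for z
      using f(3) Bv_eval_Some[OF f(1) subsetD[OF F(2) that]] that by auto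
    ultimately show "\<exists>g\<in>Hv v. Hv_norm v g \<le> B \<and> (\<forall>z\<in>F. dist (Hv_eval v z g) (u (Some z)) < e)"
      using Bv_imp_Hol_deriv_Hv[OF f(1)] by blast
  qed
  then obtain g where g: "g \<in> Hv v" "\<And>z. z \<in> disk \<Longrightarrow> Hv_eval v z g = u (Some z)"
    by blast
  obtain f where f: "f \<in> Hol" "f 0 = u None" "Hol_deriv f = g"
    using Hol_primitive[OF Hv_imp_Hol[OF g(1)]] .
  then have "f \<in> Bv v"
    using g(1) by (simp add: Bv_iff)
  then show ?thesis
    using f g(2) by (intro bexI[of _ f]) (auto simp: Bv_eval_None Bv_eval_Some)
qed

lemma norming_family_Bv:
  assumes v: "typical_weight v"
  shows "norming_family (Bv v) (Bv_norm v) Bv_index (Bv_eval v) 2"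
proof -
  interpret H: norming_family "Hv v" "Hv_norm v" disk "Hv_eval v" 1
    by (rule norming_family_Hv[OF v])
  interpret normed_fs "Bv v" "Bv_norm v"
    by (rule normed_fs_Bv[OF v])
  show ?thesis
  proof
    show "Bv_norm v f \<le> 2 * a" if f: "f \<in> Bv v" and a: "\<And>i. i \<in> Bv_index \<Longrightarrow> cmod (Bv_eval v i f) \<le> a" for f a
    proof -
      have "cmod (f 0) \<le> a"
        using a[of None] f by (simp add: Bv_eval_None)
      moreover have "Hv_norm v (Hol_deriv f) \<le> 1 * a"
      proof (rule H.norm_le[OF Bv_imp_Hol_deriv_Hv[OF f]])
        fix z assume "z \<in> disk"
        then show "cmod (Hv_eval v z (Hol_deriv f)) \<le> a"
          using a[of "Some z"] f by (simp add: Bv_eval_Some)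
      qed
      ultimately show ?thesis
        by (simp add: Bv_norm_eq)
    qed
    show "\<exists>f\<in>Bv v. \<forall>i\<in>Bv_index. Bv_eval v i f = u i"
      if "\<And>F e. \<lbrakk>finite F; F \<subseteq> Bv_index; e > 0\<rbrakk> \<Longrightarrow>
        \<exists>f\<in>Bv v. Bv_norm v f \<le> B \<and> (\<forall>i\<in>F. dist (Bv_eval v i f) (u i) < e)" for B u
      using that by (rule Bv_eval_approx_attained[OF v])
  qed (simp_all add: Bv_eval_in_dual_ball[OF v])
qed

subsection \<open>The compactness criteria\<close>

theorem
  assumes v: "typical_weight v" and X: "normed_fs X NX"
    and T: "bounded_op X NX (Hv v) (Hv_norm v) T" "linear_on_fs X T"
  shows compact_op_Hv_iff: "compact_op X NX (Hv v) (Hv_norm v) T \<longleftrightarrow>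
      rel_compact_in (norm_top_fs (dual_fs X NX) (dnorm_fs X NX))
        ((\<lambda>z. csmul (complex_of_real (v z)) (adjoint_op X T (KH v z))) ` disk)"
    and weakly_compact_op_Hv_iff: "weakly_compact_op X NX (Hv v) (Hv_norm v) T \<longleftrightarrow>
      rel_compact_in (weak_top_fs (dual_fs X NX) (dnorm_fs X NX))
        ((\<lambda>z. csmul (complex_of_real (v z)) (adjoint_op X T (KH v z))) ` disk)"
proof -
  interpret norming_family "Hv v" "Hv_norm v" disk "Hv_eval v" 1
    by (rule norming_family_Hv[OF v])
  have separable_index
    using separable_indexI[of "{}" id] continuous_on_Hv_eval[OF v] by simp
  then show "compact_op X NX (Hv v) (Hv_norm v) T \<longleftrightarrow>
      rel_compact_in (norm_top_fs (dual_fs X NX) (dnorm_fs X NX))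
        ((\<lambda>z. csmul (complex_of_real (v z)) (adjoint_op X T (KH v z))) ` disk)"
    "weakly_compact_op X NX (Hv v) (Hv_norm v) T \<longleftrightarrow>
      rel_compact_in (weak_top_fs (dual_fs X NX) (dnorm_fs X NX))
        ((\<lambda>z. csmul (complex_of_real (v z)) (adjoint_op X T (KH v z))) ` disk)"
    using compact_op_iff_adjoint[OF X T] weakly_compact_op_iff_adjoint[OF X T]
    by (simp_all add: Hv_eval_def adjoint_op_csmul)
qed

theorem
  assumes v: "typical_weight v" and X: "normed_fs X NX"
    and T: "bounded_op X NX (Bv v) (Bv_norm v) T" "linear_on_fs X T"
  shows compact_op_Bv_iff: "compact_op X NX (Bv v) (Bv_norm v) T \<longleftrightarrow>
      rel_compact_in (norm_top_fs (dual_fs X NX) (dnorm_fs X NX))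
        ((\<lambda>z. csmul (complex_of_real (v z)) (adjoint_op X T (KB1 v z))) ` disk)"
    and weakly_compact_op_Bv_iff: "weakly_compact_op X NX (Bv v) (Bv_norm v) T \<longleftrightarrow>
      rel_compact_in (weak_top_fs (dual_fs X NX) (dnorm_fs X NX))
        ((\<lambda>z. csmul (complex_of_real (v z)) (adjoint_op X T (KB1 v z))) ` disk)"
proof -
  let ?A = "(\<lambda>z. csmul (complex_of_real (v z)) (adjoint_op X T (KB1 v z))) ` disk"
  let ?a = "adjoint_op X T (Bv_eval v None)"
  interpret norming_family "Bv v" "Bv_norm v" Bv_index "Bv_eval v" 2
    by (rule norming_family_Bv[OF v])
  interpret D: norming_family "dual_fs X NX" "dnorm_fs X NX" "unit_ball_fs X NX" "dual_eval X NX" 1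
    by (rule normed_fs.norming_family_dual[OF X])
  have separable_index
    using continuous_on_Bv_eval[OF v] by (intro separable_indexI[of "{None}" Some disk]) auto
  have image: "(\<lambda>i. adjoint_op X T (Bv_eval v i)) ` Bv_index = insert ?a ?A"
    by (simp add: image_image Bv_eval_def adjoint_op_csmul)
  obtain r where kernel: "bounded_kernel (Bv v) (Bv_norm v) Bv_index (Bv_eval v) 2 (dual_fs X NX) (dnorm_fs X NX)
      (unit_ball_fs X NX) (dual_eval X NX) 1 T (\<lambda>i. adjoint_op X T (Bv_eval v i)) r"
    using bounded_kernel_adjoint[OF X T] .
  have "(\<lambda>i. adjoint_op X T (Bv_eval v i)) ` Bv_index \<subseteq> dual_fs X NX"
    using bounded_kernel.row_mem[OF kernel] by (rule image_subsetI)
  then have mem: "?a \<in> dual_fs X NX" "?A \<subseteq> dual_fs X NX"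
    unfolding image by auto
  show "compact_op X NX (Bv v) (Bv_norm v) T \<longleftrightarrow>
      rel_compact_in (norm_top_fs (dual_fs X NX) (dnorm_fs X NX)) ?A"
    using compact_op_iff_adjoint[OF X T] rel_compact_in_insert_iff[OF D.Hausdorff_norm_top_fs] mem
    unfolding image by (simp add: D.topspace_norm_top_fs)
  show "weakly_compact_op X NX (Bv v) (Bv_norm v) T \<longleftrightarrow>
      rel_compact_in (weak_top_fs (dual_fs X NX) (dnorm_fs X NX)) ?A"
    using weakly_compact_op_iff_adjoint[OF X T \<open>separable_index\<close>] rel_compact_in_insert_iff[OF D.Hausdorff_weak_top] mem
    unfolding image by simp
qed

lemma initial_space_imp_normed_fs: "initial_space X NX \<Longrightarrow> normed_fs X NX"
  by (simp add: initial_space_def is_banach_fs_imp_normed_fs)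

lemma intrinsic_imp_linear_on_fs: "\<lbrakk>intrinsic T; initial_space X NX\<rbrakk> \<Longrightarrow> linear_on_fs X T"
  unfolding intrinsic_def linear_on_Hol_def initial_space_def linear_on_fs_def by (meson subsetD)

theorem theorem3p1:
  fixes v :: "complex \<Rightarrow> real"
    and T :: "(complex \<Rightarrow> complex) \<Rightarrow> (complex \<Rightarrow> complex)"
    and X :: "(complex \<Rightarrow> complex) set"
    and NX :: "(complex \<Rightarrow> complex) \<Rightarrow> real"
  assumes "typical_weight v" and "intrinsic T" and "initial_space X NX"
  shows "(bounded_op X NX (Hv v) (Hv_norm v) T \<longrightarrow>
            (compact_op X NX (Hv v) (Hv_norm v) T \<longleftrightarrow>
               rel_compact_in (norm_top_fs (dual_fs X NX) (dnorm_fs X NX))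
                 ((\<lambda>z. csmul (complex_of_real (v z)) (adjoint_op X T (KH v z))) ` disk)) \<and>
            (weakly_compact_op X NX (Hv v) (Hv_norm v) T \<longleftrightarrow>
               rel_compact_in (weak_top_fs (dual_fs X NX) (dnorm_fs X NX))
                 ((\<lambda>z. csmul (complex_of_real (v z)) (adjoint_op X T (KH v z))) ` disk)))
       \<and> (bounded_op X NX (Bv v) (Bv_norm v) T \<longrightarrow>
            (compact_op X NX (Bv v) (Bv_norm v) T \<longleftrightarrow>
               rel_compact_in (norm_top_fs (dual_fs X NX) (dnorm_fs X NX))
                 ((\<lambda>z. csmul (complex_of_real (v z)) (adjoint_op X T (KB1 v z))) ` disk)) \<and>
            (weakly_compact_op X NX (Bv v) (Bv_norm v) T \<longleftrightarrow>
               rel_compact_in (weak_top_fs (dual_fs X NX) (dnorm_fs X NX))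
                 ((\<lambda>z. csmul (complex_of_real (v z)) (adjoint_op X T (KB1 v z))) ` disk)))"
proof -
  have X: "normed_fs X NX" and T: "linear_on_fs X T"
    using assms initial_space_imp_normed_fs intrinsic_imp_linear_on_fs by blast+
  show ?thesis
    using compact_op_Hv_iff[OF assms(1) X _ T] weakly_compact_op_Hv_iff[OF assms(1) X _ T]
      compact_op_Bv_iff[OF assms(1) X _ T] weakly_compact_op_Bv_iff[OF assms(1) X _ T]
    by (intro conjI impI)
qed

end
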